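(* Let $K=\mathrm{GF}(2)$, let $V$ be a finite dimensional vector space over $K$, and let $f:V\to V$ be a nilpotent $K$-linear map with elementary divisors $\lambda^{t_1},\dots,\lambda^{t_m}$, $0<t_1\le\cdots\le t_m$. Let $J=\{i_1,\dots,i_k\}\subseteq I_u$ with $i_1<\cdots<i_k$ and $2\le k$, and let $\vec t_J=(t_{i_1},\dots,t_{i_k})$. Suppose $\vec\mu_J=(\tilde\mu_{i_1},\dots,\tilde\mu_{i_k})\in\mathcal L(\vec t_J)$ and let $\vec\mu=(\mu_1,\dots,\mu_m)\in\mathcal L(\vec t\,)$ be the maximum extension of $\vec\mu_J$. Set $\vec r=\vec\mu+\sum_{i\in J}\vec e_i$. Then the following statements are equivalent. (i) The entries of $\vec\mu_J$ satisfy $0\le\tilde\mu_{i_1}<\cdots<\tilde\mu_{i_k}$ and $0<t_{i_1}-\tilde\mu_{i_1}<\cdots<t_{i_k}-\tilde\mu_{i_k}$. (ii) $\vec r\in\mathcal L(\vec t\,)$ and there exists a characteristic non-hyperinvariant subspace $X$ of $V$ with hyperinvariant frame $(X_H,X^h)=(W(\vec r),W(\vec\mu))$.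
   Context: A subspace of $V$ is hyperinvariant if it is invariant under all endomorphisms of $V$ that commute with $f$. It is characteristic if it is $f$-invariant and invariant under all automorphisms of $V$ that commute with $f$. For an $f$-invariant subspace $X$, $X_H$ (the hyperinvariant kernel) is the largest hyperinvariant subspace contained in $X$, $X^h$ (the hyperinvariant hull) is the smallest hyperinvariant subspace containing $X$, and the pair $(X_H,X^h)$ is the hyperinvariant frame of $X$. $I_u=\{i:\ t_i\ne t_k\text{ for all }k\ne i,\ 1\le k\le m\}$ is the set of indices of unrepeated exponents. For a nondecreasing tuple $\vec t=(t_1,\dots,t_m)$ of positive integers, $\mathcal L(\vec t\,)$ is the set of integer $m$-tuples $\vec r=(r_1,\dots,r_m)$ with $0\le r_1\le\cdots\le r_m$ and $0\le t_1-r_1\le\cdots\le t_m-r_m$, partially ordered by $\vec r\preceq\vec s$ iff $r_j\le s_j$ for all $j$. $\mathcal L(\vec t_J)$ is defined in the same way for the $k$-tuple $\vec t_J$. For $\vec r\in\mathcal L(\vec t\,)$, $W(\vec r)=\sum_{j=1}^m\big(f^{r_j}V\cap\mathrm{Ker}f^{t_j-r_j}\big)$; it is known that $\vec r\mapsto W(\vec r)$ is a bijection from $\mathcal L(\vec t\,)$ onto the set of hyperinvariant subspaces. $\vec e_1,\dots,\vec e_m$ are the standard unit row vectors of size $m$. An extension of $\vec\mu_J\in\mathcal L(\vec t_J)$ is a tuple $\vec\mu\in\mathcal L(\vec t\,)$ with $\mu_{i_s}=\tilde\mu_{i_s}$ for $s=1,\dots,k$. The set of extensions is a nonempty sublattice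 of $\mathcal L(\vec t\,)$, and its largest element with respect to $\preceq$ is called the maximum extension of $\vec\mu_J$. *)

theory Defs
  imports Complex_Main "HOL-Library.FuncSet" "HOL-Library.Z2"
begin

text \<open>
  The type \<open>bit\<close> is the field with two elements.  The underlying set of the vector space
  is a whole type; \<open>scale\<close> is the scalar multiplication.
  An \<open>m\<close>-tuple is a function on \<open>nat\<close> of which only the values at the indices
  \<open>1, \<dots>, m\<close> are relevant.
\<close>


section \<open>Hyperinvariant and characteristic subspaces\<close>

definition hyperinvariant ::
  "('k::field \<Rightarrow> 'v::ab_group_add \<Rightarrow> 'v) \<Rightarrow> ('v \<Rightarrow> 'v) \<Rightarrow> 'v set \<Rightarrow> bool" where
  "hyperinvariant scale f X \<longleftrightarrow>
     module.subspace scale X \<and>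
     (\<forall>g. Vector_Spaces.linear scale scale g \<and> g \<circ> f = f \<circ> g \<longrightarrow> g ` X \<subseteq> X)"

definition characteristic ::
  "('k::field \<Rightarrow> 'v::ab_group_add \<Rightarrow> 'v) \<Rightarrow> ('v \<Rightarrow> 'v) \<Rightarrow> 'v set \<Rightarrow> bool" where
  "characteristic scale f X \<longleftrightarrow>
     module.subspace scale X \<and> f ` X \<subseteq> X \<and>
     (\<forall>g. Vector_Spaces.linear scale scale g \<and> bij g \<and> g \<circ> f = f \<circ> g \<longrightarrow> g ` X \<subseteq> X)"

definition hyper_kernel ::
  "('k::field \<Rightarrow> 'v::ab_group_add \<Rightarrow> 'v) \<Rightarrow> ('v \<Rightarrow> 'v) \<Rightarrow> 'v set \<Rightarrow> 'v set" where
  "hyper_kernel scale f X = (GREATEST Y. hyperinvariant scale f Y \<and> Y \<subseteq> X)"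

definition hyper_hull ::
  "('k::field \<Rightarrow> 'v::ab_group_add \<Rightarrow> 'v) \<Rightarrow> ('v \<Rightarrow> 'v) \<Rightarrow> 'v set \<Rightarrow> 'v set" where
  "hyper_hull scale f X = (LEAST Y. hyperinvariant scale f Y \<and> X \<subseteq> Y)"

definition hyper_frame ::
  "('k::field \<Rightarrow> 'v::ab_group_add \<Rightarrow> 'v) \<Rightarrow> ('v \<Rightarrow> 'v) \<Rightarrow> 'v set \<Rightarrow> 'v set \<times> 'v set" where
  "hyper_frame scale f X = (hyper_kernel scale f X, hyper_hull scale f X)"

text \<open>The greatest and the least element in question always exist.\<close>

lemma hyper_kernel_greatest:
  assumes "vector_space scale" and "module.subspace scale X"
  shows "hyperinvariant scale f (hyper_kernel scale f X)"
    and "hyper_kernel scale f X \<subseteq> X"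
    and "\<And>Y. hyperinvariant scale f Y \<Longrightarrow> Y \<subseteq> X \<Longrightarrow> Y \<subseteq> hyper_kernel scale f X"
proof -
  interpret vector_space scale by fact
  define S where "S = {Y. hyperinvariant scale f Y \<and> Y \<subseteq> X}"
  define U where "U = module.span scale (\<Union>S)"
  have inv: "g ` U \<subseteq> U"
    if g: "Vector_Spaces.linear scale scale g" "g \<circ> f = f \<circ> g" for g
  proof -
    have "g ` Y \<subseteq> Y" if "Y \<in> S" for Y
      using that g unfolding S_def hyperinvariant_def by blast
    then have "g ` (\<Union>S) \<subseteq> \<Union>S" by blast
    then have "module.span scale (g ` (\<Union>S)) \<subseteq> U"
      unfolding U_def by (rule span_mono)
    moreover interpret g: Vector_Spaces.linear scale scale g by (fact g(1))
    have "g ` U = module.span scale (g ` (\<Union>S))"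
      unfolding U_def by (rule g.span_image[symmetric])
    ultimately show ?thesis by simp
  qed
  have 1: "hyperinvariant scale f U"
    using inv subspace_span unfolding hyperinvariant_def U_def by blast
  have 2: "U \<subseteq> X"
    unfolding U_def by (rule span_minimal) (use assms(2) in \<open>auto simp: S_def\<close>)
  have 3: "Y \<subseteq> U" if "hyperinvariant scale f Y" "Y \<subseteq> X" for Y
    using that span_superset[of "\<Union>S"] unfolding U_def S_def by blast
  have eq: "hyper_kernel scale f X = U"
    unfolding hyper_kernel_def by (rule Greatest_equality) (use 1 2 3 in blast)+
  show "hyperinvariant scale f (hyper_kernel scale f X)"
    unfolding eq by (rule 1)
  show "hyper_kernel scale f X \<subseteq> X"
    unfolding eq by (rule 2)
  show "\<And>Y. hyperinvariant scale f Y \<Longrightarrow> Y \<subseteq> X \<Longrightarrow> Y \<subseteq> hyper_kernel scale f X"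
    unfolding eq by (rule 3)
qed

lemma hyper_hull_least:
  assumes "vector_space scale"
  shows "hyperinvariant scale f (hyper_hull scale f X)"
    and "X \<subseteq> hyper_hull scale f X"
    and "\<And>Y. hyperinvariant scale f Y \<Longrightarrow> X \<subseteq> Y \<Longrightarrow> hyper_hull scale f X \<subseteq> Y"
proof -
  interpret vector_space scale by fact
  define S where "S = {Y. hyperinvariant scale f Y \<and> X \<subseteq> Y}"
  have "module.subspace scale (\<Inter>S)"
    by (rule subspace_Inter) (auto simp: S_def hyperinvariant_def)
  moreover have "g ` (\<Inter>S) \<subseteq> \<Inter>S"
    if g: "Vector_Spaces.linear scale scale g" "g \<circ> f = f \<circ> g" for g
  proof -
    have "g ` Y \<subseteq> Y" if "Y \<in> S" for Y
      using that g unfolding S_def hyperinvariant_def by blast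
    then show ?thesis by blast
  qed
  ultimately have 1: "hyperinvariant scale f (\<Inter>S)"
    unfolding hyperinvariant_def by blast
  have 2: "X \<subseteq> \<Inter>S" unfolding S_def by blast
  have 3: "\<Inter>S \<subseteq> Y" if "hyperinvariant scale f Y" "X \<subseteq> Y" for Y
    using that unfolding S_def by blast
  have eq: "hyper_hull scale f X = \<Inter>S"
    unfolding hyper_hull_def by (rule Least_equality) (use 1 2 3 in blast)+
  show "hyperinvariant scale f (hyper_hull scale f X)"
    unfolding eq by (rule 1)
  show "X \<subseteq> hyper_hull scale f X"
    unfolding eq by (rule 2)
  show "\<And>Y. hyperinvariant scale f Y \<Longrightarrow> X \<subseteq> Y \<Longrightarrow> hyper_hull scale f X \<subseteq> Y"
    unfolding eq by (rule 3)
qed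


section \<open>Elementary divisors\<close>

definition cyclic_subspace ::
  "('k::field \<Rightarrow> 'v::ab_group_add \<Rightarrow> 'v) \<Rightarrow> ('v \<Rightarrow> 'v) \<Rightarrow> 'v \<Rightarrow> 'v set" where
  "cyclic_subspace scale f u = module.span scale (range (\<lambda>n. (f ^^ n) u))"

text \<open>
  The elementary divisors of \<open>f\<close> are \<open>\<lambda>^(t 1), \<dots>, \<lambda>^(t m)\<close> with all \<open>t j > 0\<close>: as a module over
  the polynomial ring, with \<open>\<lambda>\<close> acting as \<open>f\<close>, the space is the direct sum of cyclic submodules
  generated by vectors \<open>u 1, \<dots>, u m\<close>, the annihilator of \<open>u j\<close> being generated by \<open>\<lambda>^(t j)\<close>.
\<close>

definition has_elementary_divisors ::
  "('k::field \<Rightarrow> 'v::ab_group_add \<Rightarrow> 'v) \<Rightarrow> ('v \<Rightarrow> 'v) \<Rightarrow> nat \<Rightarrow> (nat \<Rightarrow> nat) \<Rightarrow> bool" where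
  "has_elementary_divisors scale f m t \<longleftrightarrow>
     (\<forall>j\<in>{1..m}. 0 < t j) \<and>
     (\<exists>u. (\<forall>j\<in>{1..m}. (f ^^ t j) (u j) = 0 \<and> (f ^^ (t j - 1)) (u j) \<noteq> 0) \<and>
          (\<forall>v. \<exists>!w. w \<in> (\<Pi>\<^sub>E j\<in>{1..m}. cyclic_subspace scale f (u j)) \<and>
                    v = (\<Sum>j\<in>{1..m}. w j)))"


section \<open>The lattice of hyperinvariant tuples\<close>

definition unrepeated :: "nat \<Rightarrow> (nat \<Rightarrow> nat) \<Rightarrow> nat set" where
  "unrepeated m t = {i \<in> {1..m}. \<forall>k\<in>{1..m}. k \<noteq> i \<longrightarrow> t i \<noteq> t k}"

definition tuple_lattice :: "nat \<Rightarrow> (nat \<Rightarrow> nat) \<Rightarrow> (nat \<Rightarrow> int) set" where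
  "tuple_lattice m t =
     {r. (\<forall>j\<in>{1..m}. 0 \<le> r j \<and> 0 \<le> int (t j) - r j) \<and>
         mono_on {1..m} r \<and> mono_on {1..m} (\<lambda>j. int (t j) - r j)}"

definition tuple_le :: "nat \<Rightarrow> (nat \<Rightarrow> int) \<Rightarrow> (nat \<Rightarrow> int) \<Rightarrow> bool" where
  "tuple_le m r s \<longleftrightarrow> (\<forall>j\<in>{1..m}. r j \<le> s j)"

definition unit_row :: "nat \<Rightarrow> nat \<Rightarrow> int" where
  "unit_row i j = (if j = i then 1 else 0)"

text \<open>The conversions to \<open>nat\<close> are exact for \<open>r \<in> tuple_lattice m t\<close>.\<close>

definition W ::
  "('v::ab_group_add \<Rightarrow> 'v) \<Rightarrow> nat \<Rightarrow> (nat \<Rightarrow> nat) \<Rightarrow> (nat \<Rightarrow> int) \<Rightarrow> 'v set" where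
  "W f m t r =
     {\<Sum>j\<in>{1..m}. w j | w.
        \<forall>j\<in>{1..m}. w j \<in> range (f ^^ nat (r j)) \<inter> {v. (f ^^ nat (int (t j) - r j)) v = 0}}"

text \<open>
  A \<open>k\<close>-tuple \<open>(x\<^sub>i\<^sub>1, \<dots>, x\<^sub>i\<^sub>k)\<close> indexed by \<open>J = {i 1 < \<dots> < i k}\<close> is given by the
  function \<open>s \<mapsto> x\<^sub>i\<^sub>s\<close> on \<open>{1..k}\<close>; in particular \<open>t \<circ> i\<close> is the tuple \<open>t\<^sub>J\<close>.
\<close>

definition is_extension ::
  "nat \<Rightarrow> (nat \<Rightarrow> nat) \<Rightarrow> nat \<Rightarrow> (nat \<Rightarrow> nat) \<Rightarrow> (nat \<Rightarrow> int) \<Rightarrow> (nat \<Rightarrow> int) \<Rightarrow> bool" where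
  "is_extension m t k i \<mu>J \<mu> \<longleftrightarrow>
     \<mu> \<in> tuple_lattice m t \<and> (\<forall>s\<in>{1..k}. \<mu> (i s) = \<mu>J s)"

definition is_maximum_extension ::
  "nat \<Rightarrow> (nat \<Rightarrow> nat) \<Rightarrow> nat \<Rightarrow> (nat \<Rightarrow> nat) \<Rightarrow> (nat \<Rightarrow> int) \<Rightarrow> (nat \<Rightarrow> int) \<Rightarrow> bool" where
  "is_maximum_extension m t k i \<mu>J \<mu> \<longleftrightarrow>
     is_extension m t k i \<mu>J \<mu> \<and> (\<forall>\<nu>. is_extension m t k i \<mu>J \<nu> \<longrightarrow> tuple_le m \<nu> \<mu>)"

end

theory Submission
  imports Defs
begin

text \<open>
  Let \<open>V\<close> be the direct sum of the cyclic spaces generated by the \<open>u\<^sub>j\<close>, with projections \<open>\<pi>\<^sub>j\<close>.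
  If \<open>g\<close> commutes with \<open>f\<close> and \<open>j \<noteq> l\<close>, then \<open>h = \<pi>\<^sub>l g \<pi>\<^sub>j\<close> has square zero, so \<open>1 + h\<close> is an
  automorphism and \<open>h\<close> preserves every characteristic \<open>X\<close>.  Consequently \<open>X\<^sub>H\<close> consists of the
  vectors whose components lie in \<open>X\<close>, and \<open>X\<^sup>h\<close> is the sum of the \<open>\<pi>\<^sub>j X\<close>.

  If the frame is \<open>(W r, W \<mu>)\<close> and strictness in (i) fails for two indices of \<open>J\<close>, then for these
  indices, called \<open>b\<close> and \<open>a\<close> in a suitable order, the map \<open>u\<^sub>b \<mapsto> f\<^sup>e u\<^sub>a\<close> with \<open>e = \<mu>\<^sub>a - \<mu>\<^sub>b\<close>
  is well defined and takes \<open>f\<^bsup>\<mu>\<^sub>b\<^esup> u\<^sub>b\<close> to \<open>f\<^bsup>\<mu>\<^sub>a\<^esup> u\<^sub>a\<close>.  Applied to an element of \<open>X\<close> with \<open>b\<close>-component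
  \<open>f\<^bsup>\<mu>\<^sub>b\<^esup> u\<^sub>b\<close> it puts \<open>f\<^bsup>\<mu>\<^sub>a\<^esup> u\<^sub>a\<close> into \<open>X\<^sub>H = W r\<close>, which is absurd.

  Conversely, put \<open>z = \<Sum>\<^sub>a f\<^bsup>\<mu>\<^sub>a\<^esup> u\<^sub>a\<close> over \<open>a \<in> J\<close> and \<open>X = W r \<union> (z + W r)\<close>.  By (i) every endomorphism
  is diagonal on \<open>W \<mu> / W r\<close>, and over \<open>GF(2)\<close> the diagonal entries of an automorphism at the
  unrepeated exponents are \<open>1\<close>, so \<open>X\<close> is characteristic.
\<close>


section \<open>Endomorphisms commuting with a linear map\<close>

locale vector_space_endo = vector_space scale
  for scale :: "'k::field \<Rightarrow> 'v::ab_group_add \<Rightarrow> 'v" (infixr "*s" 75) +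
  fixes f :: "'v \<Rightarrow> 'v"
  assumes linear_f: "Vector_Spaces.linear scale scale f"
begin

definition commuting :: "('v \<Rightarrow> 'v) \<Rightarrow> bool" where
  "commuting g \<longleftrightarrow> Vector_Spaces.linear scale scale g \<and> g \<circ> f = f \<circ> g"

lemma commuting_iff:
  "commuting g \<longleftrightarrow> (\<forall>x y. g (x + y) = g x + g y) \<and> (\<forall>c x. g (c *s x) = c *s g x) \<and>
     (\<forall>x. g (f x) = f (g x))"
  unfolding commuting_def Vector_Spaces.linear_iff fun_eq_iff
  using vector_space_axioms by auto

lemma
  assumes "commuting g"
  shows commuting_add: "g (x + y) = g x + g y"
    and commuting_scale: "g (c *s x) = c *s g x"
    and commuting_apply: "g (f x) = f (g x)"
  using assms unfolding commuting_iff by auto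

lemma commuting_zero: "commuting g \<Longrightarrow> g 0 = 0"
  using commuting_scale[of g 0 0] by simp

lemma commuting_minus: "commuting g \<Longrightarrow> g (- x) = - g x"
  using commuting_scale[of g "-1" x] by simp

lemma commuting_diff: "commuting g \<Longrightarrow> g (x - y) = g x - g y"
  using commuting_add[of g x "- y"] by (simp add: commuting_minus)

lemma commuting_sum: "commuting g \<Longrightarrow> g (sum h A) = (\<Sum>a\<in>A. g (h a))"
  by (induction A rule: infinite_finite_induct) (auto simp: commuting_zero commuting_add)

lemma commuting_funpow_apply: "commuting g \<Longrightarrow> g ((f ^^ n) x) = (f ^^ n) (g x)"
  by (induction n) (auto simp: commuting_apply)

lemma commuting_f: "commuting f"
  using linear_f by (simp add: commuting_def)

lemma commuting_compose: "commuting g \<Longrightarrow> commuting h \<Longrightarrow> commuting (\<lambda>x. g (h x))"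
  unfolding commuting_iff by simp

lemma commuting_id: "commuting (\<lambda>x. x)"
  unfolding commuting_iff by simp

lemma commuting_zero_map: "commuting (\<lambda>x. 0)"
  unfolding commuting_iff using commuting_zero[OF commuting_f] by simp

lemma commuting_plus: "commuting g \<Longrightarrow> commuting h \<Longrightarrow> commuting (\<lambda>x. g x + h x)"
  using commuting_add[OF commuting_f]
  unfolding commuting_iff by (simp add: scale_right_distrib)

lemma commuting_scale_map: "commuting g \<Longrightarrow> commuting (\<lambda>x. c *s g x)"
  using commuting_scale[OF commuting_f]
  unfolding commuting_iff by (simp add: scale_right_distrib mult.commute)

lemma commuting_funpow: "commuting (f ^^ n)"
  by (induction n) (use commuting_id commuting_compose[OF commuting_f] in \<open>auto simp: id_def comp_def\<close>)

lemmas f_simps = commuting_zero[OF commuting_f] commuting_add[OF commuting_f]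
  commuting_scale[OF commuting_f]

lemmas funpow_simps = commuting_zero[OF commuting_funpow] commuting_add[OF commuting_funpow]
  commuting_scale[OF commuting_funpow] commuting_diff[OF commuting_funpow]
  commuting_minus[OF commuting_funpow]

lemma funpow_funpow: "(f ^^ a) ((f ^^ b) x) = (f ^^ (a + b)) x"
  by (simp add: funpow_add)

lemma funpow_zero_mono: "(f ^^ a) x = 0 \<Longrightarrow> a \<le> b \<Longrightarrow> (f ^^ b) x = 0"
  using funpow_funpow[of "b - a" a x] by (simp add: funpow_simps)

section \<open>Invariance under commuting maps and under automorphisms\<close>

lemma hyperinvariant_iff:
  "hyperinvariant scale f X \<longleftrightarrow> subspace X \<and> (\<forall>g x. commuting g \<longrightarrow> x \<in> X \<longrightarrow> g x \<in> X)"
  unfolding hyperinvariant_def commuting_def by blast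

lemma characteristic_iff:
  "characteristic scale f X \<longleftrightarrow> subspace X \<and> (\<forall>x\<in>X. f x \<in> X) \<and>
     (\<forall>g x. commuting g \<longrightarrow> bij g \<longrightarrow> x \<in> X \<longrightarrow> g x \<in> X)"
  unfolding characteristic_def commuting_def by blast

text \<open>The map \<open>1 + g\<close> has inverse \<open>1 - g\<close>, so \<open>X\<close>
  contains \<open>x + g x\<close> and hence the difference \<open>g x\<close>. This brings maps that
  are not invertible into play.\<close>

lemma characteristic_square_zero:
  assumes X: "characteristic scale f X" and g: "commuting g" and sq: "\<And>x. g (g x) = 0"
    and x: "x \<in> X"
  shows "g x \<in> X"
proof -
  have h: "commuting (\<lambda>x. x + g x)"
    by (intro commuting_plus commuting_id g)
  have "bij (\<lambda>x. x + g x)"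
    by (rule o_bij[of "\<lambda>x. x - g x"])
      (auto simp: fun_eq_iff commuting_add[OF g] commuting_diff[OF g] sq)
  then have "x + g x \<in> X"
    using X h x unfolding characteristic_iff by blast
  then show ?thesis
    using X x subspace_diff[of X "x + g x" x] unfolding characteristic_iff by auto
qed

text \<open>The operators \<open>p(f)\<close> for polynomials \<open>p\<close>, built up as in Horner's scheme.\<close>

inductive poly_op :: "('v \<Rightarrow> 'v) \<Rightarrow> bool" where
  zero: "poly_op (\<lambda>_. 0)"
| Horner: "poly_op p \<Longrightarrow> poly_op (\<lambda>v. c *s v + f (p v))"

lemma commuting_poly_op: "poly_op p \<Longrightarrow> commuting p"
proof (induction rule: poly_op.induct)
  case zero
  show ?case by (rule commuting_zero_map)
next
  case (Horner p c)
  then show ?case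
    by (intro commuting_plus commuting_scale_map commuting_id commuting_compose[OF commuting_f])
qed

lemma poly_op_commute:
  assumes "poly_op p" and "commuting g"
  shows "g (p v) = p (g v)"
  using assms(1)
  by induction (simp_all add: commuting_zero[OF assms(2)] commuting_add[OF assms(2)]
      commuting_scale[OF assms(2)] commuting_apply[OF assms(2)])

lemma commuting_funpow_zero:
  assumes "commuting g" and "(f ^^ n) x = 0"
  shows "(f ^^ n) (g x) = 0"
  using commuting_funpow_apply[OF assms(1), of n x] commuting_zero[OF assms(1)] assms(2) by simp

lemma poly_op_mem:
  assumes "poly_op p" "subspace X" "\<And>x. x \<in> X \<Longrightarrow> f x \<in> X" "v \<in> X"
  shows "p v \<in> X"
  using assms(1)
  by induction (use assms(2-4) in \<open>auto intro!: subspace_0 subspace_add subspace_scale\<close>)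

lemma poly_op_f:
  assumes "poly_op p"
  shows "poly_op (\<lambda>v. f (p v))"
  using Horner[OF assms, of 0] by simp

lemma poly_op_id: "poly_op (\<lambda>v. v)"
  using Horner[OF zero, of 1] by (simp add: f_simps)

lemma poly_op_funpow: "poly_op (\<lambda>v. (f ^^ n) v)"
  by (induction n) (use poly_op_id poly_op_f in auto)

lemma poly_op_add:
  assumes "poly_op p" "poly_op q"
  shows "poly_op (\<lambda>v. p v + q v)"
  using assms
proof (induction arbitrary: q rule: poly_op.induct)
  case zero
  then show ?case by simp
next
  case (Horner p c)
  note p = Horner
  from p(3) show ?case
  proof cases
    case zero
    then show ?thesis using poly_op.Horner[OF p(1), of c] by simp
  next
    case (Horner q' d)
    show ?thesis
      using poly_op.Horner[OF p(2)[OF Horner(2)], of "c + d"] Horner(1)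
      by (simp add: f_simps scale_left_distrib algebra_simps)
  qed
qed

lemma poly_op_scale: "poly_op p \<Longrightarrow> poly_op (\<lambda>v. c *s p v)"
proof (induction rule: poly_op.induct)
  case zero
  then show ?case using poly_op.zero by simp
next
  case (Horner p d)
  show ?case using poly_op.Horner[OF Horner(2), of "c * d"]
    by (simp add: f_simps scale_right_distrib)
qed

section \<open>Cyclic subspaces and divisibility by powers of \<open>f\<close>\<close>

lemma cyclic_subspace_eq: "cyclic_subspace scale f u = {p u | p. poly_op p}"
proof
  have "subspace {p u | p. poly_op p}"
    unfolding subspace_def using zero poly_op_add poly_op_scale by (auto; fastforce)
  moreover have "range (\<lambda>n. (f ^^ n) u) \<subseteq> {p u | p. poly_op p}"
    using poly_op_funpow by blast
  ultimately show "cyclic_subspace scale f u \<subseteq> {p u | p. poly_op p}"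
    unfolding cyclic_subspace_def by (rule span_minimal[rotated])
next
  \<comment> \<open>The reverse inclusion needs only that the span contains \<open>u\<close> and is
    closed under \<open>f\<close>.\<close>
  have inv: "f x \<in> cyclic_subspace scale f u" if "x \<in> cyclic_subspace scale f u" for x
  proof -
    interpret f: Vector_Spaces.linear scale scale f by (rule linear_f)
    have "f ` range (\<lambda>n. (f ^^ n) u) \<subseteq> range (\<lambda>n. (f ^^ n) u)"
      by (auto intro: range_eqI[of _ _ "Suc _"])
    then have "span (f ` range (\<lambda>n. (f ^^ n) u)) \<subseteq> cyclic_subspace scale f u"
      unfolding cyclic_subspace_def by (rule span_mono)
    then show ?thesis
      using that f.span_image[of "range (\<lambda>n. (f ^^ n) u)"] unfolding cyclic_subspace_def by auto
  qed
  have "u \<in> cyclic_subspace scale f u"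
    unfolding cyclic_subspace_def by (rule span_base) (auto intro: range_eqI[of _ _ 0])
  then show "{p u | p. poly_op p} \<subseteq> cyclic_subspace scale f u"
    using poly_op_mem[of _ "cyclic_subspace scale f u" u] inv
    by (auto simp: cyclic_subspace_def)
qed

lemma cyclic_subspaceE:
  assumes "x \<in> cyclic_subspace scale f u"
  obtains p where "poly_op p" "x = p u"
  using assms unfolding cyclic_subspace_eq by auto

lemma cyclic_subspaceI: "poly_op p \<Longrightarrow> p u \<in> cyclic_subspace scale f u"
  unfolding cyclic_subspace_eq by auto

lemma subspace_cyclic_subspace: "subspace (cyclic_subspace scale f u)"
  unfolding cyclic_subspace_def by simp

lemma cyclic_subspace_base: "u \<in> cyclic_subspace scale f u"
  unfolding cyclic_subspace_def by (rule span_base) (auto intro: range_eqI[of _ _ 0])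

lemma cyclic_subspace_f:
  "x \<in> cyclic_subspace scale f u \<Longrightarrow> f x \<in> cyclic_subspace scale f u"
  by (metis cyclic_subspaceE cyclic_subspaceI poly_op_f)

lemma cyclic_subspace_funpow:
  "x \<in> cyclic_subspace scale f u \<Longrightarrow> (f ^^ n) x \<in> cyclic_subspace scale f u"
  by (induction n) (auto intro: cyclic_subspace_f)

lemma cyclic_subspace_annihilated:
  "x \<in> cyclic_subspace scale f u \<Longrightarrow> (f ^^ n) u = 0 \<Longrightarrow> (f ^^ n) x = 0"
  by (metis cyclic_subspaceE commuting_funpow_zero commuting_poly_op)

text \<open>Splits off the constant term of a polynomial representing \<open>x\<close>; it is used
  to isolate the constant term of a diagonal entry.\<close>

lemma cyclic_subspace_Horner:
  assumes "x \<in> cyclic_subspace scale f u"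
  obtains c y where "y \<in> cyclic_subspace scale f u" "x = c *s u + f y"
proof -
  obtain p where "poly_op p" "x = p u"
    using assms by (rule cyclic_subspaceE)
  then show ?thesis
  proof cases
    case zero
    then show ?thesis
      using that[of 0 0] \<open>x = p u\<close> subspace_0[OF subspace_cyclic_subspace] by (simp add: f_simps)
  next
    case (Horner q c)
    then show ?thesis
      using that[of "q u" c] \<open>x = p u\<close> cyclic_subspaceI by simp
  qed
qed

text \<open>A nonzero constant term of the remaining factor would survive under
  \<open>f ^^ (t - 1)\<close>, so factors \<open>f\<close> can be stripped off one at a time. The
  quotient is an identity of operators, so it may be evaluated at vectors other than
  \<open>u\<close>.\<close>

lemma poly_op_divide:
  assumes p: "poly_op p" and u: "(f ^^ t) u = 0" "(f ^^ (t - 1)) u \<noteq> 0"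
    and s: "(f ^^ s) (p u) = 0" and "n + s \<le> t"
  shows "\<exists>q. poly_op q \<and> (\<forall>v. p v = (f ^^ n) (q v))"
  using \<open>n + s \<le> t\<close>
proof (induction n)
  case 0
  then show ?case using p by auto
next
  case (Suc n)
  then obtain q where q: "poly_op q" "\<And>v. p v = (f ^^ n) (q v)" by auto
  from q(1) show ?case
  proof cases
    case zero
    then show ?thesis using q(2) by (intro exI[of _ q]) (simp add: poly_op.zero funpow_simps f_simps)
  next
    case (Horner q' c)
    \<comment> \<open>The power is chosen so that only the constant term \<open>c\<close> of
      \<open>q\<close> survives, as \<open>f ^^ t\<close> kills the rest. The subtraction is exact
      because \<open>Suc n + s \<le> t\<close>.\<close>
    have "0 = (f ^^ (t - 1 - n - s)) ((f ^^ s) (p u))"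
      using s by (simp add: funpow_simps)
    also have "\<dots> = (f ^^ (t - 1)) (q u)"
      unfolding q(2) funpow_funpow using Suc.prems by simp
    also have "\<dots> = c *s (f ^^ (t - 1)) u + (f ^^ t) (q' u)"
      using Suc.prems unfolding Horner(1) funpow_simps
      by (cases t) (simp_all add: funpow_swap1)
    also have "(f ^^ t) (q' u) = 0"
      using u(1) Horner(2) commuting_poly_op commuting_funpow_zero by blast
    finally have "c = 0" using u(2) by simp
    then show ?thesis
      using q(2) Horner by (intro exI[of _ q']) (simp add: funpow_swap1)
  qed
qed

lemma cyclic_subspace_kernel:
  assumes x: "x \<in> cyclic_subspace scale f u" "(f ^^ s) x = 0"
    and u: "(f ^^ t) u = 0" "(f ^^ (t - 1)) u \<noteq> 0" and "n + s \<le> t"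
  shows "x \<in> (f ^^ n) ` cyclic_subspace scale f u"
proof -
  obtain p where p: "poly_op p" "x = p u"
    using x(1) by (rule cyclic_subspaceE)
  then obtain q where "poly_op q" "p u = (f ^^ n) (q u)"
    using poly_op_divide[OF p(1) u _ \<open>n + s \<le> t\<close>] x(2) by auto
  then show ?thesis
    using p cyclic_subspaceI by simp
qed

text \<open>The difference of \<open>p\<close> and \<open>q\<close> vanishes at \<open>u\<close>, so
  it is divisible by \<open>f ^^ t\<close> and kills \<open>v\<close>. Hence a map prescribed on a
  generator is well defined.\<close>

lemma poly_op_eq:
  assumes "poly_op p" "poly_op q" "p u = q u"
    and u: "(f ^^ t) u = 0" "(f ^^ (t - 1)) u \<noteq> 0" and v: "(f ^^ t) v = 0"
  shows "p v = q v"
proof -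
  have d: "poly_op (\<lambda>v. p v + (- 1) *s q v)"
    by (intro poly_op_add poly_op_scale assms(1,2))
  obtain h where h: "poly_op h" "p v + (- 1) *s q v = (f ^^ t) (h v)"
    using poly_op_divide[OF d u, of 0 t] assms(3) by auto
  have "(f ^^ t) (h v) = 0"
    using h(1) v commuting_poly_op commuting_funpow_zero by blast
  then show ?thesis using h(2) by simp
qed

lemma hyperinvariant_W: "hyperinvariant scale f (W f m t r)"
  unfolding hyperinvariant_iff
proof (intro conjI allI impI)
  let ?A = "\<lambda>j. range (f ^^ nat (r j)) \<inter> {v. (f ^^ nat (int (t j) - r j)) v = 0}"
  have A: "subspace (?A j)" for j
  proof (rule subspace_inter)
    show "subspace (range (f ^^ n))" for n
      unfolding subspace_def
    proof (intro conjI ballI allI)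
      show "0 \<in> range (f ^^ n)"
        by (rule range_eqI[of _ _ 0]) (simp add: funpow_simps)
    next
      fix x y assume "x \<in> range (f ^^ n)" "y \<in> range (f ^^ n)"
      then show "x + y \<in> range (f ^^ n)"
        by (auto simp flip: commuting_add[OF commuting_funpow])
    next
      fix c x assume "x \<in> range (f ^^ n)"
      then show "c *s x \<in> range (f ^^ n)"
        by (auto simp flip: commuting_scale[OF commuting_funpow])
    qed
    show "subspace {v. (f ^^ n) v = 0}" for n
      unfolding subspace_def by (auto simp: funpow_simps)
  qed
  have W: "W f m t r = {\<Sum>j\<in>{1..m}. w j | w. \<forall>j\<in>{1..m}. w j \<in> ?A j}"
    by (simp add: W_def)
  show "subspace (W f m t r)"
    unfolding subspace_def
  proof (intro conjI ballI allI)
    show "0 \<in> W f m t r"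
      unfolding W using subspace_0[OF A] by (auto intro!: exI[of _ "\<lambda>_. 0"])
  next
    fix x y assume "x \<in> W f m t r" "y \<in> W f m t r"
    then obtain w w' where "x = sum w {1..m}" "\<forall>j\<in>{1..m}. w j \<in> ?A j"
      "y = sum w' {1..m}" "\<forall>j\<in>{1..m}. w' j \<in> ?A j"
      unfolding W by blast
    then show "x + y \<in> W f m t r"
      unfolding W using subspace_add[OF A]
      by (intro CollectI exI[of _ "\<lambda>j. w j + w' j"]) (simp add: sum.distrib)
  next
    fix c x assume "x \<in> W f m t r"
    then obtain w where "x = sum w {1..m}" "\<forall>j\<in>{1..m}. w j \<in> ?A j"
      unfolding W by blast
    then show "c *s x \<in> W f m t r"
      unfolding W using subspace_scale[OF A]
      by (intro CollectI exI[of _ "\<lambda>j. c *s w j"]) (simp add: scale_sum_right)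
  qed
  fix g x assume g: "commuting g" and "x \<in> W f m t r"
  then obtain w where w: "x = sum w {1..m}" "\<forall>j\<in>{1..m}. w j \<in> ?A j"
    unfolding W by blast
  have "g y \<in> ?A j" if "y \<in> ?A j" for y j
    using that commuting_funpow_zero[OF g] by (auto simp: commuting_funpow_apply[OF g])
  then show "g x \<in> W f m t r"
    unfolding W using w by (intro CollectI exI[of _ "\<lambda>j. g (w j)"]) (simp add: commuting_sum[OF g])
qed

end


section \<open>Direct sums of cyclic subspaces\<close>

locale cyclic_decomposition = vector_space_endo scale f
  for scale :: "'k::field \<Rightarrow> 'v::ab_group_add \<Rightarrow> 'v" (infixr "*s" 75) and f :: "'v \<Rightarrow> 'v" +
  fixes m :: nat and t :: "nat \<Rightarrow> nat" and u :: "nat \<Rightarrow> 'v"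
  assumes u_annihilated: "j \<in> {1..m} \<Longrightarrow> (f ^^ t j) (u j) = 0"
    and u_exponent: "j \<in> {1..m} \<Longrightarrow> (f ^^ (t j - 1)) (u j) \<noteq> 0"
    and decomposition: "\<exists>!w. w \<in> (\<Pi>\<^sub>E j\<in>{1..m}. cyclic_subspace scale f (u j)) \<and>
      v = (\<Sum>j\<in>{1..m}. w j)"
begin

context
  notes One_nat_def [simp del]
begin

section \<open>Projections onto the cyclic summands\<close>

abbreviation cyc :: "nat \<Rightarrow> 'v set" where
  "cyc j \<equiv> cyclic_subspace scale f (u j)"

text \<open>\<open>PiE\<close> fixes \<open>w\<close> to be \<open>undefined\<close> off
  \<open>{1..m}\<close>, which makes it unique as a function. The projection is
  \<open>undefined\<close> for such \<open>j\<close>, hence the index hypotheses below.\<close>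

definition proj :: "nat \<Rightarrow> 'v \<Rightarrow> 'v" where
  "proj j v = (THE w. w \<in> (\<Pi>\<^sub>E j\<in>{1..m}. cyc j) \<and> v = (\<Sum>j\<in>{1..m}. w j)) j"

lemma proj_mem: "j \<in> {1..m} \<Longrightarrow> proj j v \<in> cyc j"
  and sum_proj: "(\<Sum>j\<in>{1..m}. proj j v) = v"
  using theI'[OF decomposition[of v]] unfolding proj_def by (auto simp: PiE_iff)

lemma proj_unique:
  assumes "\<And>j. j \<in> {1..m} \<Longrightarrow> w j \<in> cyc j" and "v = (\<Sum>j\<in>{1..m}. w j)" and "j \<in> {1..m}"
  shows "proj j v = w j"
proof -
  have "(THE w. w \<in> (\<Pi>\<^sub>E j\<in>{1..m}. cyc j) \<and> v = (\<Sum>j\<in>{1..m}. w j)) = restrict w {1..m}"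
    by (rule the1_equality[OF decomposition]) (use assms in auto)
  then show ?thesis
    unfolding proj_def using assms(3) by simp
qed

lemma commuting_proj:
  assumes "j \<in> {1..m}"
  shows "commuting (proj j)"
  unfolding commuting_iff
proof (intro conjI allI)
  fix x y c
  show "proj j (x + y) = proj j x + proj j y"
    by (rule proj_unique[OF _ _ assms])
      (auto simp: sum.distrib sum_proj intro!: subspace_add subspace_cyclic_subspace proj_mem)
  show "proj j (c *s x) = c *s proj j x"
    by (rule proj_unique[OF _ _ assms])
      (auto simp: sum_proj simp flip: scale_sum_right
        intro!: subspace_scale subspace_cyclic_subspace proj_mem)
  show "proj j (f x) = f (proj j x)"
    by (rule proj_unique[OF _ _ assms])
      (auto simp: sum_proj simp flip: commuting_sum[OF commuting_f]
        intro!: cyclic_subspace_f proj_mem)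
qed

lemma proj_cyc:
  assumes "j \<in> {1..m}" "l \<in> {1..m}" "x \<in> cyc l"
  shows "proj j x = (if j = l then x else 0)"
  by (rule proj_unique[OF _ _ assms(1)])
    (use assms in \<open>auto simp: subspace_0[OF subspace_cyclic_subspace]\<close>)

lemmas proj_zero = commuting_zero[OF commuting_proj]
lemmas proj_add = commuting_add[OF commuting_proj]
lemmas proj_diff = commuting_diff[OF commuting_proj]
lemmas proj_funpow = commuting_funpow_apply[OF commuting_proj]

lemma cyc_annihilated: "j \<in> {1..m} \<Longrightarrow> x \<in> cyc j \<Longrightarrow> t j \<le> n \<Longrightarrow> (f ^^ n) x = 0"
  using cyclic_subspace_annihilated[OF _ u_annihilated] funpow_zero_mono by blast

lemma cyc_kernel:
  assumes "j \<in> {1..m}" "x \<in> cyc j" "(f ^^ s) x = 0" "n + s \<le> t j"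
  shows "x \<in> (f ^^ n) ` cyc j"
  using assms cyclic_subspace_kernel u_annihilated u_exponent by blast

lemma funpow_cyc_antimono:
  assumes "x \<in> (f ^^ n) ` cyc j" "n' \<le> n"
  shows "x \<in> (f ^^ n') ` cyc j"
proof -
  obtain y where y: "y \<in> cyc j" "x = (f ^^ n) y" using assms by auto
  then have "x = (f ^^ n') ((f ^^ (n - n')) y)"
    using assms(2) by (simp add: funpow_funpow)
  then show ?thesis using cyclic_subspace_funpow[OF y(1)] by blast
qed

lemma subspace_funpow_cyc: "subspace ((f ^^ n) ` cyc j)"
proof -
  interpret g: Vector_Spaces.linear scale scale "f ^^ n"
    using commuting_funpow by (simp add: commuting_def)
  show ?thesis by (rule g.subspace_image[OF subspace_cyclic_subspace])
qed

text \<open>Otherwise a further power of \<open>f\<close> would turn the equation into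
  \<open>(f ^^ (t j - 1)) (u j) = (f ^^ t j) y = 0\<close>.\<close>

lemma funpow_generator_notin:
  assumes "j \<in> {1..m}" "n < t j"
  shows "(f ^^ n) (u j) \<notin> (f ^^ Suc n) ` cyc j"
proof
  assume "(f ^^ n) (u j) \<in> (f ^^ Suc n) ` cyc j"
  then obtain y where y: "y \<in> cyc j" "(f ^^ n) (u j) = (f ^^ Suc n) y" by blast
  have "(f ^^ (t j - 1)) (u j) = (f ^^ (t j - 1 - n)) ((f ^^ n) (u j))"
    unfolding funpow_funpow using assms(2) by simp
  also have "\<dots> = (f ^^ t j) y"
    unfolding y(2) funpow_funpow using assms(2) by simp
  also have "\<dots> = 0" using cyc_annihilated[OF assms(1) y(1)] by simp
  finally show False using u_exponent[OF assms(1)] by simp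
qed

text \<open>
  The map \<open>p(f) u\<^sub>b \<mapsto> p(f) v\<close>, extended by zero on the other summands; it is independent of
  the chosen \<open>p\<close> when \<open>f\<^bsup>t b\<^esup> v = 0\<close>.
\<close>

definition transfer :: "nat \<Rightarrow> 'v \<Rightarrow> 'v \<Rightarrow> 'v" where
  "transfer b v x = (SOME p. poly_op p \<and> p (u b) = proj b x) v"

lemma transfer_eq:
  assumes "b \<in> {1..m}" "(f ^^ t b) v = 0" "poly_op p" "p (u b) = proj b x"
  shows "transfer b v x = p v"
proof -
  let ?q = "SOME p. poly_op p \<and> p (u b) = proj b x"
  have "poly_op ?q \<and> ?q (u b) = proj b x"
    by (rule someI[of _ p]) (use assms in auto)
  then have "?q v = p v"
    using poly_op_eq[of ?q p "u b" "t b" v] assms u_annihilated u_exponent by auto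
  then show ?thesis unfolding transfer_def .
qed

lemma transferE:
  assumes "b \<in> {1..m}" "(f ^^ t b) v = 0"
  obtains p where "poly_op p" "p (u b) = proj b x" "transfer b v x = p v"
  using cyclic_subspaceE[OF proj_mem[OF assms(1)], of x] transfer_eq[OF assms] by metis

lemma commuting_transfer:
  assumes b: "b \<in> {1..m}" "(f ^^ t b) v = 0"
  shows "commuting (transfer b v)"
  unfolding commuting_iff
proof (intro conjI allI)
  note P = commuting_proj[OF b(1)]
  fix x y c
  obtain p where p: "poly_op p" "p (u b) = proj b x" "transfer b v x = p v"
    using transferE[OF b] .
  obtain q where q: "poly_op q" "q (u b) = proj b y" "transfer b v y = q v"
    using transferE[OF b] .
  show "transfer b v (x + y) = transfer b v x + transfer b v y"
    using transfer_eq[OF b poly_op_add[OF p(1) q(1)], of "x + y"] p q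
    by (simp add: commuting_add[OF P])
  show "transfer b v (c *s x) = c *s transfer b v x"
    using transfer_eq[OF b poly_op_scale[OF p(1)], of c "c *s x"] p
    by (simp add: commuting_scale[OF P])
  show "transfer b v (f x) = f (transfer b v x)"
    using transfer_eq[OF b poly_op_f[OF p(1)], of "f x"] p
    by (simp add: commuting_apply[OF P])
qed

lemma transfer_funpow_generator:
  assumes b: "b \<in> {1..m}" "(f ^^ t b) v = 0" and x: "proj b x = (f ^^ n) (u b)"
  shows "transfer b v x = (f ^^ n) v"
  using transfer_eq[OF b poly_op_funpow] x by simp

text \<open>The image lies in \<open>cyc a\<close>, where the projection to \<open>cyc b\<close>
  vanishes.\<close>

lemma transfer_square_zero:
  assumes b: "b \<in> {1..m}" "(f ^^ t b) v = 0" and a: "a \<in> {1..m}" "a \<noteq> b" "v \<in> cyc a"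
  shows "transfer b v (transfer b v x) = 0"
proof -
  obtain p where "poly_op p" "transfer b v x = p v"
    using transferE[OF b] by metis
  then have "transfer b v x \<in> cyc a"
    using poly_op_mem[OF _ subspace_cyclic_subspace cyclic_subspace_f a(3)] by simp
  then have "proj b (transfer b v x) = 0"
    using proj_cyc[OF b(1) a(1)] a(2) by simp
  then show ?thesis
    using transfer_eq[OF b poly_op.zero] by simp
qed

section \<open>Blocks of commuting maps and the frame of a characteristic subspace\<close>

lemma characteristic_component:
  assumes "characteristic scale f X" "commuting g" "j \<in> {1..m}" "l \<in> {1..m}" "j \<noteq> l" "x \<in> X"
  shows "proj l (g (proj j x)) \<in> X"
proof (rule characteristic_square_zero[OF assms(1) _ _ assms(6)])
  show "commuting (\<lambda>x. proj l (g (proj j x)))"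
    by (intro commuting_compose[OF commuting_proj] commuting_compose[OF assms(2)]
        commuting_proj assms)
  \<comment> \<open>The square vanishes because \<open>proj j\<close> kills
    \<open>cyc l\<close>.\<close>
  show "proj l (g (proj j (proj l (g (proj j x))))) = 0" for x
    using proj_cyc[OF assms(3,4) proj_mem[OF assms(4)]] assms(5) commuting_zero[OF assms(2)]
      proj_zero[OF assms(4)] by simp
qed

text \<open>A map of \<open>cyc l\<close> commuting with \<open>f\<close> is determined by the image
  of the generator, so it acts as a polynomial in \<open>f\<close>. Diagonal blocks therefore
  preserve every \<open>f\<close>-invariant subspace of \<open>cyc l\<close>.\<close>

lemma diagonal_component:
  assumes g: "commuting g" and l: "l \<in> {1..m}"
  obtains p where "poly_op p" "\<And>x. proj l (g (proj l x)) = p (proj l x)"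
proof -
  have h: "commuting (\<lambda>x. proj l (g x))"
    by (intro commuting_compose[OF commuting_proj] g l)
  obtain p where p: "poly_op p" "proj l (g (u l)) = p (u l)"
    using cyclic_subspaceE[OF proj_mem[OF l]] .
  have "proj l (g (proj l x)) = p (proj l x)" for x
  proof -
    obtain q where q: "poly_op q" "proj l x = q (u l)"
      using cyclic_subspaceE[OF proj_mem[OF l]] .
    show ?thesis
      unfolding q(2) using poly_op_commute[OF q(1) h, of "u l"] p(2)
        poly_op_commute[OF q(1) commuting_poly_op[OF p(1)]] by simp
  qed
  with p(1) show ?thesis by (rule that)
qed

text \<open>Expands \<open>proj l (g x)\<close> into blocks: \<open>off\<close> treats
  \<open>j \<noteq> l\<close>, and \<open>diag\<close> covers \<open>j = l\<close> by
  \<open>diagonal_component\<close>. It serves the kernel with \<open>P j = X\<close> and the hull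
  with \<open>P j\<close> the image of \<open>X\<close> under \<open>proj j\<close>.\<close>

lemma hyperinvariant_if_components:
  assumes X: "characteristic scale f X" and P: "\<And>j. j \<in> {1..m} \<Longrightarrow> subspace (P j)"
    and off: "\<And>g j l x. commuting g \<Longrightarrow> j \<in> {1..m} \<Longrightarrow> l \<in> {1..m} \<Longrightarrow> j \<noteq> l \<Longrightarrow> proj j x \<in> P j
      \<Longrightarrow> proj l (g (proj j x)) \<in> P l"
    and diag: "\<And>p j x. poly_op p \<Longrightarrow> j \<in> {1..m} \<Longrightarrow> proj j x \<in> P j \<Longrightarrow> p (proj j x) \<in> P j"
  shows "hyperinvariant scale f {x. \<forall>j\<in>{1..m}. proj j x \<in> P j}"
  unfolding hyperinvariant_iff
proof (intro conjI allI impI)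
  show "subspace {x. \<forall>j\<in>{1..m}. proj j x \<in> P j}"
    unfolding subspace_def
    by (auto simp: proj_zero proj_add commuting_scale[OF commuting_proj]
        intro!: subspace_0 subspace_add subspace_scale P)
  fix g x assume g: "commuting g" and x: "x \<in> {x. \<forall>j\<in>{1..m}. proj j x \<in> P j}"
  have "proj l (g x) \<in> P l" if l: "l \<in> {1..m}" for l
  proof -
    have h: "commuting (\<lambda>x. proj l (g x))"
      by (intro commuting_compose[OF commuting_proj] g l)
    obtain p where p: "poly_op p" "\<And>x. proj l (g (proj l x)) = p (proj l x)"
      using diagonal_component[OF g l] by blast
    have "proj l (g (proj j x)) \<in> P l" if j: "j \<in> {1..m}" for j
      using off[OF g j l, of x] diag[OF p(1) l, of x] p(2) x j by (cases "j = l") auto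
    then have "(\<Sum>j\<in>{1..m}. proj l (g (proj j x))) \<in> P l"
      by (intro subspace_sum P l)
    then show ?thesis
      using commuting_sum[OF h, of "\<lambda>j. proj j x" "{1..m}"] by (simp add: sum_proj)
  qed
  then show "g x \<in> {x. \<forall>j\<in>{1..m}. proj j x \<in> P j}" by simp
qed

lemma components_in_hyper_kernel:
  assumes X: "characteristic scale f X"
  shows "{x. \<forall>j\<in>{1..m}. proj j x \<in> X} \<subseteq> hyper_kernel scale f X"
proof (rule hyper_kernel_greatest(3)[OF vector_space_axioms])
  have S: "subspace X" and fX: "\<And>x. x \<in> X \<Longrightarrow> f x \<in> X"
    using X unfolding characteristic_iff by auto
  show "subspace X" by fact
  show "hyperinvariant scale f {x. \<forall>j\<in>{1..m}. proj j x \<in> X}"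
  proof (rule hyperinvariant_if_components[OF X S])
    fix g j l x
    assume "commuting g" and j: "j \<in> {1..m}" and "l \<in> {1..m}" "j \<noteq> l" "proj j x \<in> X"
    then show "proj l (g (proj j x)) \<in> X"
      using characteristic_component[OF X, of g j l "proj j x"] proj_cyc[OF j j proj_mem[OF j]]
      by simp
  next
    fix p j x assume "poly_op p" "proj j x \<in> X"
    then show "p (proj j x) \<in> X" using poly_op_mem[OF _ S fX] by blast
  qed
  show "{x. \<forall>j\<in>{1..m}. proj j x \<in> X} \<subseteq> X"
  proof
    fix x assume "x \<in> {x. \<forall>j\<in>{1..m}. proj j x \<in> X}"
    then have "(\<Sum>j\<in>{1..m}. proj j x) \<in> X"
      by (intro subspace_sum[OF S]) simp
    then show "x \<in> X" by (simp add: sum_proj)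
  qed
qed

lemma hyper_hull_in_components:
  assumes X: "characteristic scale f X"
  shows "hyper_hull scale f X \<subseteq> {x. \<forall>j\<in>{1..m}. proj j x \<in> proj j ` X}"
proof (rule hyper_hull_least(3)[OF vector_space_axioms])
  have S: "subspace X" and fX: "\<And>x. x \<in> X \<Longrightarrow> f x \<in> X"
    using X unfolding characteristic_iff by auto
  show "hyperinvariant scale f {x. \<forall>j\<in>{1..m}. proj j x \<in> proj j ` X}"
  proof (rule hyperinvariant_if_components[OF X])
    fix j assume j: "j \<in> {1..m}"
    interpret g: Vector_Spaces.linear scale scale "proj j"
      using commuting_proj[OF j] by (simp add: commuting_def)
    show "subspace (proj j ` X)" by (rule g.subspace_image[OF S])
  next
    fix g j l x
    assume *: "commuting g" "j \<in> {1..m}" "l \<in> {1..m}" "j \<noteq> l" "proj j x \<in> proj j ` X"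
    then obtain y where y: "y \<in> X" "proj j x = proj j y" by blast
    have "proj l (g (proj j y)) \<in> X"
      using characteristic_component[OF X *(1-4) y(1)] .
    then show "proj l (g (proj j x)) \<in> proj l ` X"
      using y(2) proj_cyc[OF *(3,3) proj_mem[OF *(3)]] by (metis image_eqI)
  next
    fix p j x assume p: "poly_op p" and j: "j \<in> {1..m}" and "proj j x \<in> proj j ` X"
    then obtain y where "y \<in> X" "proj j x = proj j y" by blast
    then show "p (proj j x) \<in> proj j ` X"
      using poly_op_mem[OF p S fX] poly_op_commute[OF p commuting_proj[OF j]] by (metis image_eqI)
  qed
  show "X \<subseteq> {x. \<forall>j\<in>{1..m}. proj j x \<in> proj j ` X}" by blast
qed

text \<open>Presents \<open>W\<close> as a direct sum adapted to the generators, so that membership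
  can be tested in each component separately.\<close>

lemma W_eq:
  assumes r: "r \<in> tuple_lattice m t"
  shows "W f m t r = {x. \<forall>j\<in>{1..m}. proj j x \<in> (f ^^ nat (r j)) ` cyc j}"
proof (intro equalityI subsetI)
  fix x assume "x \<in> W f m t r"
  then obtain w where w: "x = (\<Sum>j\<in>{1..m}. w j)"
    "\<And>j. j \<in> {1..m} \<Longrightarrow> w j \<in> range (f ^^ nat (r j))"
    "\<And>j. j \<in> {1..m} \<Longrightarrow> (f ^^ nat (int (t j) - r j)) (w j) = 0"
    unfolding W_def by blast
  have "proj l x \<in> (f ^^ nat (r l)) ` cyc l" if l: "l \<in> {1..m}" for l
  proof -
    \<comment> \<open>For \<open>l \<le> j\<close> monotonicity of \<open>r\<close> gives enough
      factors \<open>f\<close>; for \<open>j < l\<close> monotonicity of \<open>t - r\<close> makes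
      the kernel exponent small enough for \<open>cyc_kernel\<close>.\<close>
    have "proj l (w j) \<in> (f ^^ nat (r l)) ` cyc l" if j: "j \<in> {1..m}" for j
    proof (cases "l \<le> j")
      case True
      obtain v where v: "w j = (f ^^ nat (r j)) v" using w(2)[OF j] by blast
      have "proj l (w j) \<in> (f ^^ nat (r j)) ` cyc l"
        unfolding v proj_funpow[OF l] using proj_mem[OF l] by blast
      moreover have "nat (r l) \<le> nat (r j)"
        using r l j True mono_onD[of "{1..m}" r l j] unfolding tuple_lattice_def by auto
      ultimately show ?thesis by (rule funpow_cyc_antimono)
    next
      case False
      have "int (t j) - r j \<le> int (t l) - r l"
        using r l j False mono_onD[of "{1..m}" "\<lambda>j. int (t j) - r j" j l]
        unfolding tuple_lattice_def by auto
      moreover have "0 \<le> r l" "0 \<le> int (t j) - r j"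
        using r l j unfolding tuple_lattice_def by auto
      ultimately have "nat (r l) + nat (int (t j) - r j) \<le> t l" by linarith
      moreover have "(f ^^ nat (int (t j) - r j)) (proj l (w j)) = 0"
        using commuting_funpow_zero[OF commuting_proj[OF l] w(3)[OF j]] .
      ultimately show ?thesis
        using cyc_kernel[OF l proj_mem[OF l]] by blast
    qed
    then show ?thesis
      unfolding w(1) commuting_sum[OF commuting_proj[OF l]]
      by (intro subspace_sum subspace_funpow_cyc)
  qed
  then show "x \<in> {x. \<forall>j\<in>{1..m}. proj j x \<in> (f ^^ nat (r j)) ` cyc j}" by simp
next
  fix x assume x: "x \<in> {x. \<forall>j\<in>{1..m}. proj j x \<in> (f ^^ nat (r j)) ` cyc j}"
  have "proj j x \<in> range (f ^^ nat (r j)) \<inter> {v. (f ^^ nat (int (t j) - r j)) v = 0}"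
    if j: "j \<in> {1..m}" for j
  proof -
    obtain y where y: "y \<in> cyc j" "proj j x = (f ^^ nat (r j)) y" using x j by blast
    have "nat (int (t j) - r j) + nat (r j) = t j"
      using r j unfolding tuple_lattice_def by fastforce
    then show ?thesis
      using y cyc_annihilated[OF j y(1)] by (simp add: funpow_funpow)
  qed
  then show "x \<in> W f m t r"
    unfolding W_def by (auto simp: sum_proj intro!: exI[of _ "\<lambda>j. proj j x"])
qed

text \<open>In \<open>le\<close>, the first inequality makes the exponent in \<open>v\<close>
  nonnegative and the second makes \<open>u b \<mapsto> v\<close> a legitimate map. Since
  \<open>r a = \<mu> a + 1\<close>, the vector it produces in the kernel is not in
  \<open>W f m t r\<close>.\<close>

lemma frame_gap:
  assumes X: "characteristic scale f X"
    and frame: "hyper_frame scale f X = (W f m t r, W f m t \<mu>)"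
    and \<mu>: "\<mu> \<in> tuple_lattice m t" and r: "r \<in> tuple_lattice m t"
    and a: "a \<in> {1..m}" and b: "b \<in> {1..m}" and "a \<noteq> b" and ra: "r a = \<mu> a + 1"
    and le: "\<mu> b \<le> \<mu> a" "int (t a) - \<mu> a \<le> int (t b) - \<mu> b"
  shows False
proof -
  define v where "v = (f ^^ nat (\<mu> a - \<mu> b)) (u a)"
  have v: "v \<in> cyc a"
    unfolding v_def using cyclic_subspace_funpow cyclic_subspace_base .
  have nn: "0 \<le> \<mu> b" "0 \<le> \<mu> a" "0 \<le> int (t a) - (\<mu> a + 1)"
    using \<mu> r a b ra[symmetric] unfolding tuple_lattice_def by auto
  then have e: "nat (\<mu> b) + nat (\<mu> a - \<mu> b) = nat (\<mu> a)" "nat (\<mu> a) < t a"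
    "Suc (nat (\<mu> a)) = nat (r a)"
    using le ra by auto
  \<comment> \<open>The second inequality in \<open>le\<close> says
    \<open>t a \<le> t b + (\<mu> a - \<mu> b)\<close>, and \<open>f ^^ t a\<close> kills
    \<open>u a\<close>.\<close>
  have bv: "(f ^^ t b) v = 0"
    unfolding v_def funpow_funpow
    by (rule cyc_annihilated[OF a cyclic_subspace_base]) (use le nn in linarith)
  have "proj j ((f ^^ nat (\<mu> b)) (u b)) \<in> (f ^^ nat (\<mu> j)) ` cyc j" if "j \<in> {1..m}" for j
    using proj_cyc[OF that b cyclic_subspace_funpow[OF cyclic_subspace_base]]
      subspace_0[OF subspace_funpow_cyc] cyclic_subspace_base by auto
  then have "(f ^^ nat (\<mu> b)) (u b) \<in> hyper_hull scale f X"
    using frame W_eq[OF \<mu>] unfolding hyper_frame_def by auto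
  \<comment> \<open>The vector in the hull need not lie in \<open>X\<close>, but some
    \<open>y\<close> in \<open>X\<close> has the same \<open>b\<close>-component, and
    \<open>transfer b v\<close> depends on nothing else.\<close>
  then obtain y where y: "y \<in> X" "proj b ((f ^^ nat (\<mu> b)) (u b)) = proj b y"
    using hyper_hull_in_components[OF X] b by blast
  then have "proj b y = (f ^^ nat (\<mu> b)) (u b)"
    using proj_cyc[OF b b cyclic_subspace_funpow[OF cyclic_subspace_base]] by simp
  then have "transfer b v y = (f ^^ nat (\<mu> a)) (u a)"
    using transfer_funpow_generator[OF b bv] e(1) unfolding v_def by (simp add: funpow_funpow)
  moreover have "transfer b v y \<in> X"
    using characteristic_square_zero[OF X commuting_transfer[OF b bv]
        transfer_square_zero[OF b bv a \<open>a \<noteq> b\<close> v] y(1)] .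
  ultimately have "(f ^^ nat (\<mu> a)) (u a) \<in> X" by simp
  moreover have "0 \<in> X" using X subspace_0 unfolding characteristic_iff by blast
  \<comment> \<open>Its only nonzero component is the vector itself, so it falls into the
    hyperinvariant kernel.\<close>
  ultimately have "(f ^^ nat (\<mu> a)) (u a) \<in> {x. \<forall>j\<in>{1..m}. proj j x \<in> X}"
    using proj_cyc[OF _ a cyclic_subspace_funpow[OF cyclic_subspace_base]] by simp
  then have "(f ^^ nat (\<mu> a)) (u a) \<in> W f m t r"
    using components_in_hyper_kernel[OF X] frame unfolding hyper_frame_def by auto
  then have "proj a ((f ^^ nat (\<mu> a)) (u a)) \<in> (f ^^ nat (r a)) ` cyc a"
    using W_eq[OF r] a by blast
  then have "(f ^^ nat (\<mu> a)) (u a) \<in> (f ^^ nat (r a)) ` cyc a"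
    using proj_cyc[OF a a cyclic_subspace_funpow[OF cyclic_subspace_base]] by simp
  then show False
    using funpow_generator_notin[OF a e(2)] unfolding e(3) by simp
qed

text \<open>
  With \<open>n = t a\<close>, an automorphism preserves \<open>f\<^sup>n V\<close>.  If the constant term of its diagonal entry
  at \<open>a\<close> vanished, it would map \<open>f\<^bsup>n-1\<^esup> u\<^sub>a\<close> into \<open>f\<^sup>n V\<close>, all other exponents being different from \<open>n\<close>.
\<close>

lemma automorphism_diagonal:
  assumes a: "a \<in> unrepeated m t" "0 < t a" and g: "commuting g" "bij g"
  obtains c y where "c \<noteq> 0" "y \<in> cyc a" "proj a (g (u a)) = c *s u a + f y"
proof -
  have a1: "a \<in> {1..m}" using a unfolding unrepeated_def by auto
  obtain c y where cy: "y \<in> cyc a" "proj a (g (u a)) = c *s u a + f y"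
    using cyclic_subspace_Horner[OF proj_mem[OF a1]] .
  have "c \<noteq> 0"
  proof
    assume "c = 0"
    define n where "n = t a - 1"
    have n: "Suc n = t a" using a(2) n_def by simp
    let ?x = "(f ^^ n) (u a)"
    have "proj j (g ?x) \<in> (f ^^ Suc n) ` cyc j" if j: "j \<in> {1..m}" for j
    proof -
      have eq: "proj j (g ?x) = (f ^^ n) (proj j (g (u a)))"
        by (simp add: commuting_funpow_apply[OF g(1)] proj_funpow[OF j])
      have zero: "(f ^^ t a) (proj j (g (u a))) = 0"
        by (intro commuting_funpow_zero[OF commuting_proj[OF j]] commuting_funpow_zero[OF g(1)]
            u_annihilated a1)
      \<comment> \<open>Unrepeatedness excludes \<open>t j = t a\<close> for
        \<open>j \<noteq> a\<close>. Shorter summands are killed by \<open>f ^^ n\<close>; in longer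
        ones a vector killed by \<open>f ^^ t a\<close> is divisible by \<open>f\<close>.\<close>
      consider "j = a" | "t j \<le> n" | "j \<noteq> a" "t a < t j"
        using a(1) j n less_Suc_eq_le[of "t j" n] linorder_neqE_nat[of "t a" "t j"]
        unfolding unrepeated_def by fastforce
      then show ?thesis
      proof cases
        case 1
        then show ?thesis
          using eq cy \<open>c = 0\<close> by (auto simp flip: funpow_swap1)
      next
        case 2
        then show ?thesis
          using eq cyc_annihilated[OF j proj_mem[OF j]] subspace_0[OF subspace_funpow_cyc[of "Suc n"]]
          by simp
      next
        case 3
        then have "proj j (g (u a)) \<in> (f ^^ 1) ` cyc j"
          using cyc_kernel[OF j proj_mem[OF j] zero, of 1] by simp
        then show ?thesis
          using eq by (auto simp: funpow_funpow Suc_eq_plus1 simp del: funpow.simps)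
      qed
    qed
    then have "\<forall>j. \<exists>w. j \<in> {1..m} \<longrightarrow> proj j (g ?x) = (f ^^ Suc n) w"
      by blast
    then obtain w where w: "\<And>j. j \<in> {1..m} \<Longrightarrow> proj j (g ?x) = (f ^^ Suc n) (w j)"
      by metis
    have "(\<Sum>j\<in>{1..m}. proj j (g ?x)) = (\<Sum>j\<in>{1..m}. (f ^^ Suc n) (w j))"
      by (rule sum.cong[OF refl w])
    then have "g ?x = (f ^^ Suc n) (\<Sum>j\<in>{1..m}. w j)"
      unfolding commuting_sum[OF commuting_funpow] sum_proj .
    \<comment> \<open>Surjectivity writes the sum as \<open>g s\<close> and injectivity cancels
      \<open>g\<close>. Then \<open>?x = (f ^^ t a) s\<close>, whose \<open>a\<close>-component is
      zero.\<close>
    moreover obtain s where "(\<Sum>j\<in>{1..m}. w j) = g s"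
      using g(2) by (metis bij_pointE)
    ultimately have "?x = (f ^^ Suc n) s"
      using g(2) commuting_funpow_apply[OF g(1), of "Suc n" s] by (metis bij_is_inj injD)
    then have "proj a ?x = (f ^^ Suc n) (proj a s)"
      by (simp only: proj_funpow[OF a1])
    also have "\<dots> = 0" using cyc_annihilated[OF a1 proj_mem[OF a1]] n by simp
    finally show False
      using proj_cyc[OF a1 a1 cyclic_subspace_funpow[OF cyclic_subspace_base]]
        u_exponent[OF a1] n_def by simp
  qed
  with cy show ?thesis using that by blast
qed

text \<open>The locale allows any field, and \<open>two\<close> restricts it to two elements.
  \<open>gap\<close> supplies the divisibility that pushes off-diagonal images into
  \<open>W f m t r\<close>; two distinct indices in \<open>J\<close> keep the kernel from growing
  beyond it.\<close>

lemma exists_characteristic_frame: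
  assumes two: "\<And>c :: 'k. c \<noteq> 0 \<Longrightarrow> c = 1"
    and J: "J \<subseteq> unrepeated m t" and a0: "a0 \<in> J" "b0 \<in> J" "a0 \<noteq> b0"
    and \<mu>: "\<mu> \<in> tuple_lattice m t" and r: "r \<in> tuple_lattice m t"
    and r_eq: "\<And>j. r j = \<mu> j + (if j \<in> J then 1 else 0)"
    and gap: "\<And>a j. a \<in> J \<Longrightarrow> j \<in> {1..m} \<Longrightarrow> j \<noteq> a \<Longrightarrow>
      r j \<le> \<mu> a + max 0 (int (t j) - int (t a))"
  shows "\<exists>X. characteristic scale f X \<and> \<not> hyperinvariant scale f X \<and>
    hyper_frame scale f X = (W f m t r, W f m t \<mu>)"
proof -
  have J1: "a \<in> {1..m}" if "a \<in> J" for a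
    using that J unfolding unrepeated_def by auto
  have finJ: "finite J"
    using J unfolding unrepeated_def by (rule finite_subset) simp
  have \<mu>0: "0 \<le> \<mu> j" if "j \<in> {1..m}" for j
    using \<mu> that unfolding tuple_lattice_def by blast
  have \<mu>t: "nat (\<mu> a) < t a" if "a \<in> J" for a
  proof -
    have "0 \<le> int (t a) - r a" using r J1[OF that] unfolding tuple_lattice_def by blast
    then show ?thesis using r_eq[of a] that \<mu>0[OF J1[OF that]] by simp
  qed
  have Suc: "nat (r a) = Suc (nat (\<mu> a))" if "a \<in> J" for a
    using r_eq[of a] that \<mu>0[OF J1[OF that]] by simp
  define e where "e a = (f ^^ nat (\<mu> a)) (u a)" for a
  define z where "z = (\<Sum>a\<in>J. e a)"
  define R where "R = W f m t r"
  \<comment> \<open>With two scalars this is the sum of \<open>R\<close> and the span of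
    \<open>z\<close>.\<close>
  define X where "X = R \<union> {x. x - z \<in> R}"
  note We = W_eq[OF r, folded R_def]
  have e_cyc: "e a \<in> cyc a" for a
    unfolding e_def by (rule cyclic_subspace_funpow[OF cyclic_subspace_base])
  have proj_e: "proj j (e a) = (if j = a then e a else 0)" if "a \<in> {1..m}" "j \<in> {1..m}" for j a
    using proj_cyc[OF that(2,1) e_cyc] by simp
  have proj_z: "proj j z = (if j \<in> J then e j else 0)" if j: "j \<in> {1..m}" for j
  proof -
    have "proj j z = (\<Sum>a\<in>J. if j = a then e a else 0)"
      unfolding z_def commuting_sum[OF commuting_proj[OF j]]
      by (rule sum.cong) (use proj_e J1 j in auto)
    then show ?thesis using finJ by simp
  qed
  have e_notin: "e a \<notin> (f ^^ nat (r a)) ` cyc a" if "a \<in> J" for a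
    unfolding e_def Suc[OF that] using funpow_generator_notin[OF J1[OF that] \<mu>t[OF that]] .
  have hR: "hyperinvariant scale f R" and h\<mu>: "hyperinvariant scale f (W f m t \<mu>)"
    unfolding R_def by (rule hyperinvariant_W)+
  then have sR: "subspace R" and s\<mu>: "subspace (W f m t \<mu>)"
    and gR: "\<And>g x. commuting g \<Longrightarrow> x \<in> R \<Longrightarrow> g x \<in> R"
    unfolding hyperinvariant_iff by auto
  have zR: "z \<notin> R"
    using proj_z[OF J1[OF a0(1)]] e_notin[OF a0(1)] J1[OF a0(1)] a0(1) unfolding We by force
  have sX: "subspace X"
    unfolding subspace_def
  proof (intro conjI ballI allI)
    show "0 \<in> X" using subspace_0[OF sR] X_def by blast
  next
    fix x y assume xy: "x \<in> X" "y \<in> X"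
    have "(1 + 1 :: 'k) = 0"
    proof (rule ccontr)
      assume "(1 + 1 :: 'k) \<noteq> 0"
      then have "(1 + 1 :: 'k) = 1 + 0" using two by simp
      then show False unfolding add_left_cancel by simp
    qed
    then have zz: "z + z = 0" using scale_left_distrib[of 1 1 z] by simp
    from xy consider "x \<in> R" "y \<in> R" | "x \<in> R" "y - z \<in> R" | "x - z \<in> R" "y \<in> R"
      | "x - z \<in> R" "y - z \<in> R"
      unfolding X_def by blast
    then show "x + y \<in> X"
    proof cases
      case 1
      then show ?thesis unfolding X_def using subspace_add[OF sR] by blast
    next
      case 2
      then show ?thesis unfolding X_def using subspace_add[OF sR 2] by (simp add: algebra_simps)
    next
      case 3
      then show ?thesis unfolding X_def using subspace_add[OF sR 3] by (simp add: algebra_simps)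
    next
      case 4
      have "(x - z) + (y - z) = x + y - (z + z)" by (simp add: algebra_simps)
      then have "(x - z) + (y - z) = x + y" using zz by (simp only: diff_zero)
      then have "x + y \<in> R" using subspace_add[OF sR 4] by (simp only:)
      then show ?thesis unfolding X_def by blast
    qed
  next
    fix c x assume "x \<in> X"
    then show "c *s x \<in> X"
      using two[of c] subspace_0[OF sR] X_def by (cases "c = 0") auto
  qed
  \<comment> \<open>The image of \<open>u a\<close> is killed by \<open>f ^^ t a\<close>, hence
    divisible by \<open>f ^^ (t j - t a)\<close> in longer summands; \<open>gap\<close> then reaches
    \<open>r j\<close>.\<close>
  have e_ops: "proj j (g (e a)) \<in> (f ^^ nat (r j)) ` cyc j"
    if "a \<in> J" "j \<in> {1..m}" "j \<noteq> a" "commuting g" for g a j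
  proof -
    have *: "r j \<le> \<mu> a + max 0 (int (t j) - int (t a))" "r j \<le> int (t j)" "0 \<le> \<mu> a"
      using gap[OF that(1-3)] r that(2) \<mu>0[OF J1[OF that(1)]] unfolding tuple_lattice_def by auto
    show ?thesis
    proof (cases "t j \<le> t a")
      case True
      have "(f ^^ nat (\<mu> a)) (proj j (g (u a))) \<in> (f ^^ nat (\<mu> a)) ` cyc j"
        using proj_mem[OF that(2)] by blast
      then show ?thesis
        unfolding e_def commuting_funpow_apply[OF that(4)] proj_funpow[OF that(2)]
        by (rule funpow_cyc_antimono) (use * True in linarith)
    next
      case False
      have zero: "(f ^^ t a) (proj j (g (u a))) = 0"
        by (intro commuting_funpow_zero[OF commuting_proj[OF that(2)]]
            commuting_funpow_zero[OF that(4)] u_annihilated J1 that)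
      have "proj j (g (u a)) \<in> (f ^^ (t j - t a)) ` cyc j"
        by (rule cyc_kernel[OF that(2) proj_mem[OF that(2)] zero]) (use False in simp)
      then have "(f ^^ nat (\<mu> a)) (proj j (g (u a))) \<in> (f ^^ (nat (\<mu> a) + (t j - t a))) ` cyc j"
        by (auto simp: funpow_funpow)
      then show ?thesis
        unfolding e_def commuting_funpow_apply[OF that(4)] proj_funpow[OF that(2)]
        by (rule funpow_cyc_antimono) (use * False in linarith)
    qed
  qed
  have aut_z: "g z - z \<in> R" if g: "commuting g" "bij g" for g
  proof -
    have "g (e a) - e a \<in> R" if a: "a \<in> J" for a
    proof -
      have "proj j (g (e a) - e a) \<in> (f ^^ nat (r j)) ` cyc j" if j: "j \<in> {1..m}" for j
      proof (cases "j = a")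
        case False
        then show ?thesis
          using e_ops[OF a j _ g(1)] proj_e[OF J1[OF a] j] by (simp add: proj_diff[OF j])
      next
        case True
        have "a \<in> unrepeated m t" "0 < t a" using J a \<mu>t[OF a] by auto
        then obtain c y where "c \<noteq> 0" "y \<in> cyc a" "proj a (g (u a)) = c *s u a + f y"
          using g by (rule automorphism_diagonal)
        \<comment> \<open>With \<open>c = 1\<close> the leading term of
          \<open>proj a (g (e a))\<close> cancels against \<open>e a\<close>, and the remainder has
          one more factor \<open>f\<close>.\<close>
        then have y: "y \<in> cyc a" "proj a (g (u a)) = u a + f y"
          using two[of c] by auto
        have "proj a (g (e a)) - e a = (f ^^ Suc (nat (\<mu> a))) y"
          unfolding e_def commuting_funpow_apply[OF g(1)] proj_funpow[OF J1[OF a]] y(2)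
          by (simp add: funpow_simps funpow_swap1)
        then show ?thesis
          using y(1) True proj_e[OF J1[OF a] J1[OF a]] Suc[OF a]
          by (auto simp: proj_diff[OF J1[OF a]] simp del: funpow.simps)
      qed
      then show ?thesis unfolding We by blast
    qed
    then have "(\<Sum>a\<in>J. g (e a) - e a) \<in> R" by (rule subspace_sum[OF sR])
    then show ?thesis unfolding z_def by (simp add: commuting_sum[OF g(1)] sum_subtractf)
  qed
  have aut: "g x \<in> X" if g: "commuting g" "bij g" and x: "x \<in> X" for g x
  proof (cases "x \<in> R")
    case True
    then show ?thesis using gR[OF g(1)] X_def by blast
  next
    case False
    then have "g (x - z) + (g z - z) \<in> R"
      using x gR[OF g(1)] aut_z[OF g] subspace_add[OF sR] unfolding X_def by blast
    then show ?thesis by (simp add: X_def commuting_diff[OF g(1)])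
  qed
  have f_e: "f (e a) \<in> R" if a: "a \<in> J" for a
  proof -
    have "proj j (f (e a)) \<in> (f ^^ nat (r j)) ` cyc j" if j: "j \<in> {1..m}" for j
    proof (cases "j = a")
      case False
      then show ?thesis using e_ops[OF a j _ commuting_f] by simp
    next
      case True
      have "f (e a) = (f ^^ nat (r a)) (u a)" unfolding e_def Suc[OF a] by simp
      then show ?thesis
        using True proj_cyc[OF j j cyclic_subspace_funpow[OF cyclic_subspace_base]]
          cyclic_subspace_base by auto
    qed
    then show ?thesis unfolding We by blast
  qed
  have fX: "f x \<in> X" if x: "x \<in> X" for x
  proof (cases "x \<in> R")
    case True
    then show ?thesis using gR[OF commuting_f] X_def by blast
  next
    case False
    have "(\<Sum>a\<in>J. f (e a)) \<in> R" by (rule subspace_sum[OF sR f_e])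
    then have "f z \<in> R" unfolding z_def commuting_sum[OF commuting_f] .
    moreover have "f (x - z) \<in> R" using False x gR[OF commuting_f] X_def by blast
    ultimately have "f (x - z) + f z \<in> R" using subspace_add[OF sR] by blast
    then show ?thesis by (simp add: X_def commuting_diff[OF commuting_f])
  qed
  have char: "characteristic scale f X"
    unfolding characteristic_iff using sX fX aut by blast
  have kernel: "hyper_kernel scale f X = R"
  proof
    note k = hyper_kernel_greatest[OF vector_space_axioms sX]
    show "R \<subseteq> hyper_kernel scale f X"
      by (rule k(3)[OF hR]) (simp add: X_def)
    have "x \<in> R" if x: "x \<in> hyper_kernel scale f X" for x
    proof -
      have "proj j x \<in> R" if j: "j \<in> {1..m}" for j
      proof (rule ccontr)
        assume "proj j x \<notin> R"
        moreover have "proj j x \<in> X"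
          using k(1)[of f] k(2) commuting_proj[OF j] x unfolding hyperinvariant_iff by blast
        ultimately have pz: "proj j x - z \<in> R" unfolding X_def by blast
        \<comment> \<open>At a second index of \<open>J\<close> the vector
          \<open>proj j x - z\<close> has component \<open>- e a\<close>, which no element of
          \<open>R\<close> has.\<close>
        obtain a where a: "a \<in> J" "a \<noteq> j" using a0 by metis
        have "proj a (proj j x - z) = - e a"
          using a proj_cyc[OF J1[OF a(1)] j proj_mem[OF j]] proj_z[OF J1[OF a(1)]]
          by (simp add: proj_diff[OF J1[OF a(1)]])
        then have "- e a \<in> (f ^^ nat (r a)) ` cyc a"
          using pz J1[OF a(1)] unfolding We by force
        then have "e a \<in> (f ^^ nat (r a)) ` cyc a"
          using subspace_neg[OF subspace_funpow_cyc, of "- e a"] by simp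
        then show False using e_notin[OF a(1)] by blast
      qed
      then have "(\<Sum>j\<in>{1..m}. proj j x) \<in> R" by (rule subspace_sum[OF sR])
      then show ?thesis by (simp add: sum_proj)
    qed
    then show "hyper_kernel scale f X \<subseteq> R" by blast
  qed
  have z\<mu>: "e a \<in> W f m t \<mu>" if a: "a \<in> J" for a
  proof -
    have "proj j (e a) \<in> (f ^^ nat (\<mu> j)) ` cyc j" if "j \<in> {1..m}" for j
      using proj_e[OF J1[OF a] that] subspace_0[OF subspace_funpow_cyc] cyclic_subspace_base
      unfolding e_def by auto
    then show ?thesis unfolding W_eq[OF \<mu>] by blast
  qed
  have R\<mu>: "R \<subseteq> W f m t \<mu>"
  proof -
    have "nat (\<mu> j) \<le> nat (r j)" for j using r_eq[of j] by auto
    then show ?thesis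
      unfolding We W_eq[OF \<mu>] using funpow_cyc_antimono by blast
  qed
  have hull: "hyper_hull scale f X = W f m t \<mu>"
  proof
    note h = hyper_hull_least[OF vector_space_axioms, where f = f and X = X]
    have zW: "z \<in> W f m t \<mu>" unfolding z_def by (rule subspace_sum[OF s\<mu> z\<mu>])
    have "x \<in> W f m t \<mu>" if "x - z \<in> R" for x
      using subspace_add[OF s\<mu> subsetD[OF R\<mu> that] zW] by simp
    then have "X \<subseteq> W f m t \<mu>" using R\<mu> X_def by blast
    then show "hyper_hull scale f X \<subseteq> W f m t \<mu>" by (rule h(3)[OF h\<mu>])
    have sH: "subspace (hyper_hull scale f X)"
      and gH: "\<And>g x. commuting g \<Longrightarrow> x \<in> hyper_hull scale f X \<Longrightarrow> g x \<in> hyper_hull scale f X"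
      using h(1) unfolding hyperinvariant_iff by auto
    have eH: "e a \<in> hyper_hull scale f X" if a: "a \<in> J" for a
    proof -
      have "z \<in> hyper_hull scale f X" using h(2) subspace_0[OF sR] X_def by auto
      then show ?thesis
        using gH[OF commuting_proj[OF J1[OF a]], of z] proj_z[OF J1[OF a]] a by simp
    qed
    have "x \<in> hyper_hull scale f X" if x: "x \<in> W f m t \<mu>" for x
    proof -
      have "proj j x \<in> hyper_hull scale f X" if j: "j \<in> {1..m}" for j
      proof -
        obtain y where y: "y \<in> cyc j" "proj j x = (f ^^ nat (\<mu> j)) y"
          using x j unfolding W_eq[OF \<mu>] by blast
        obtain p where p: "poly_op p" "y = p (u j)"
          using cyclic_subspaceE[OF y(1)] .
        have pe: "proj j x = p (e j)"
          unfolding e_def y(2) p(2) using poly_op_commute[OF p(1) commuting_funpow] .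
        show ?thesis
        \<comment> \<open>For \<open>j\<close> in \<open>J\<close> the hull contains
          \<open>e j\<close> and its polynomial multiples; otherwise \<open>r\<close> and \<mu>
          agree at \<open>j\<close> and the component already lies in \<open>R\<close>.\<close>
        proof (cases "j \<in> J")
          case True
          then show ?thesis
            unfolding pe by (rule gH[OF commuting_poly_op[OF p(1)] eH])
        next
          case False
          then have rj: "r j = \<mu> j" using r_eq[of j] by simp
          have "proj l (proj j x) \<in> (f ^^ nat (r l)) ` cyc l" if l: "l \<in> {1..m}" for l
            using x j rj proj_cyc[OF l j proj_mem[OF j]] subspace_0[OF subspace_funpow_cyc]
            unfolding W_eq[OF \<mu>] by (cases "l = j") (simp_all del: atLeastAtMost_iff)
          then have "proj j x \<in> R" unfolding We by blast
          then show ?thesis using h(2) X_def by blast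
        qed
      qed
      then have "(\<Sum>j\<in>{1..m}. proj j x) \<in> hyper_hull scale f X" by (rule subspace_sum[OF sH])
      then show ?thesis by (simp add: sum_proj)
    qed
    then show "W f m t \<mu> \<subseteq> hyper_hull scale f X" by blast
  qed
  have "\<not> hyperinvariant scale f X"
  proof
    assume "hyperinvariant scale f X"
    then have "X \<subseteq> R"
      using hyper_kernel_greatest(3)[OF vector_space_axioms sX] kernel by blast
    then show False using zR subspace_0[OF sR] X_def by auto
  qed
  then show ?thesis
    using char kernel hull unfolding hyper_frame_def R_def by blast
qed

end

end


section \<open>Maximum extensions\<close>

text \<open>
  The maximum extension is \<open>\<mu> j = min (t j) (min\<^sub>s (\<mu>J s + max 0 (t j - t (i s))))\<close>: as a function
  of \<open>t j\<close>, each of these terms is nondecreasing and has slope at most \<open>1\<close>.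
\<close>

lemma maximum_extension_ge:
  assumes t: "mono_on {1..m} t" and i: "mono_on {1..k} i"
    and \<mu>J: "\<mu>J \<in> tuple_lattice k (t \<circ> i)" and \<mu>: "is_maximum_extension m t k i \<mu>J \<mu>"
    and j: "j \<in> {1..m}" and c: "c \<le> int (t j)"
    and cs: "\<And>s. s \<in> {1..k} \<Longrightarrow> c \<le> \<mu>J s + max 0 (int (t j) - int (t (i s)))"
  shows "c \<le> \<mu> j"
proof -
  \<comment> \<open>An explicit extension, hence a lower bound for the maximum one. The entry
    \<open>t l\<close> also keeps the set under \<open>Min\<close> nonempty.\<close>
  define \<nu> where "\<nu> l = Min (insert (int (t l))
    ((\<lambda>s. \<mu>J s + max 0 (int (t l) - int (t (i s)))) ` {1..k}))" for l
  have \<nu>_ge: "x \<le> \<nu> l \<longleftrightarrow>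
    x \<le> int (t l) \<and> (\<forall>s\<in>{1..k}. x \<le> \<mu>J s + max 0 (int (t l) - int (t (i s))))" for x l
    unfolding \<nu>_def by (subst Min_ge_iff) auto
  have \<nu>_le1: "\<nu> l \<le> int (t l)" for l
    using \<nu>_ge[of "\<nu> l" l] by blast
  have \<nu>_le2: "\<nu> l \<le> \<mu>J s + max 0 (int (t l) - int (t (i s)))" if "s \<in> {1..k}" for l s
    using \<nu>_ge[of "\<nu> l" l] that by blast
  have \<mu>J0: "0 \<le> \<mu>J s" "\<mu>J s \<le> int (t (i s))" if "s \<in> {1..k}" for s
    using \<mu>J that unfolding tuple_lattice_def by auto
  have tm: "int (t l) \<le> int (t l')" if "l \<in> {1..m}" "l' \<in> {1..m}" "l \<le> l'" for l l'
    using mono_onD[OF t that] by simp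
  have "\<nu> \<in> tuple_lattice m t"
    unfolding tuple_lattice_def
  proof (intro CollectI conjI ballI mono_onI)
    fix l assume "l \<in> {1..m}"
    show "0 \<le> \<nu> l" unfolding \<nu>_ge using \<mu>J0(1) by fastforce
    show "0 \<le> int (t l) - \<nu> l" using \<nu>_le1[of l] by simp
  next
    fix l l' assume l: "l \<in> {1..m}" "l' \<in> {1..m}" "l \<le> l'"
    show "\<nu> l \<le> \<nu> l'"
      unfolding \<nu>_ge[of _ l']
    proof (intro conjI ballI)
      show "\<nu> l \<le> int (t l')" using \<nu>_le1[of l] tm[OF l] by simp
      fix s assume "s \<in> {1..k}"
      then show "\<nu> l \<le> \<mu>J s + max 0 (int (t l') - int (t (i s)))"
        using \<nu>_le2[of s l] tm[OF l] by linarith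
    qed
    have "\<nu> l' - (int (t l') - int (t l)) \<le> \<nu> l"
      unfolding \<nu>_ge[of _ l]
    proof (intro conjI ballI)
      show "\<nu> l' - (int (t l') - int (t l)) \<le> int (t l)" using \<nu>_le1[of l'] by simp
      fix s assume "s \<in> {1..k}"
      then show "\<nu> l' - (int (t l') - int (t l)) \<le> \<mu>J s + max 0 (int (t l) - int (t (i s)))"
        using \<nu>_le2[of s l'] tm[OF l] by linarith
    qed
    then show "int (t l) - \<nu> l \<le> int (t l') - \<nu> l'" by simp
  qed
  moreover have "\<nu> (i s) = \<mu>J s" if s: "s \<in> {1..k}" for s
  proof (rule antisym)
    show "\<nu> (i s) \<le> \<mu>J s" using \<nu>_le2[OF s, of "i s"] by simp
    \<comment> \<open>No other term undercuts the prescribed value: monotonicity of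
      \<open>\<mu>J\<close> handles later indices, that of the differences earlier ones.\<close>
    have "\<mu>J s \<le> \<mu>J s' + max 0 (int (t (i s)) - int (t (i s')))" if s': "s' \<in> {1..k}" for s'
    proof (cases "s \<le> s'")
      case True
      then have "\<mu>J s \<le> \<mu>J s'"
        using \<mu>J mono_onD[of "{1..k}" \<mu>J, OF _ s s'] unfolding tuple_lattice_def by blast
      then show ?thesis by simp
    next
      case False
      then have "int (t (i s')) - \<mu>J s' \<le> int (t (i s)) - \<mu>J s"
        using \<mu>J mono_onD[of "{1..k}" "\<lambda>j. int ((t \<circ> i) j) - \<mu>J j", OF _ s' s]
        unfolding tuple_lattice_def by simp
      then show ?thesis by simp
    qed
    then show "\<mu>J s \<le> \<nu> (i s)" unfolding \<nu>_ge using \<mu>J0(2)[OF s] by blast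
  qed
  ultimately have "is_extension m t k i \<mu>J \<nu>" unfolding is_extension_def by blast
  then have "\<nu> j \<le> \<mu> j"
    using \<mu> j unfolding is_maximum_extension_def tuple_le_def by blast
  moreover have "c \<le> \<nu> j" unfolding \<nu>_ge using c cs by blast
  ultimately show ?thesis by simp
qed

text \<open>Maximality spreads strictness from \<open>J\<close> to all other indices
  \<open>l\<close>: the bound reads \<open>\<mu>J s < \<mu> l\<close> if
  \<open>t l > t (i s)\<close>, and \<open>t l - \<mu> l < t (i s) - \<mu>J s\<close> if
  \<open>t l < t (i s)\<close>. Each term of the minimum respects it, the term of \<open>s\<close>
  itself because \<open>t (i s)\<close> is unrepeated.\<close>

lemma maximum_extension_gap:
  assumes t: "mono_on {1..m} t" and i: "strict_mono_on {1..k} i"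
    and J: "i ` {1..k} \<subseteq> unrepeated m t"
    and \<mu>J: "\<mu>J \<in> tuple_lattice k (t \<circ> i)" and \<mu>: "is_maximum_extension m t k i \<mu>J \<mu>"
    and strict: "strict_mono_on {1..k} \<mu>J" "strict_mono_on {1..k} (\<lambda>s. int (t (i s)) - \<mu>J s)"
    and pos: "\<And>s. s \<in> {1..k} \<Longrightarrow> \<mu>J s < int (t (i s))"
    and s: "s \<in> {1..k}" and l: "l \<in> {1..m}" "l \<noteq> i s"
  shows "\<mu>J s + 1 + min 0 (int (t l) - int (t (i s))) \<le> \<mu> l"
proof (rule maximum_extension_ge[OF t strict_mono_on_imp_mono_on[OF i] \<mu>J \<mu> l(1)])
  have is1: "i s \<in> {1..m}" "i s \<in> unrepeated m t" using J s unfolding unrepeated_def by blast+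
  show "\<mu>J s + 1 + min 0 (int (t l) - int (t (i s))) \<le> int (t l)"
    using pos[OF s] by auto
  fix s' assume s': "s' \<in> {1..k}"
  consider "s' < s" | "s' = s" | "s < s'" by linarith
  then show "\<mu>J s + 1 + min 0 (int (t l) - int (t (i s)))
    \<le> \<mu>J s' + max 0 (int (t l) - int (t (i s')))"
  proof cases
    case 1
    then show ?thesis using strict_mono_onD[OF strict(2) s' s] by auto
  next
    case 2
    have "t l \<noteq> t (i s)" using is1 l unfolding unrepeated_def by auto
    then show ?thesis using 2 by auto
  next
    case 3
    then show ?thesis using strict_mono_onD[OF strict(1) s s'] by auto
  qed
qed

theorem theorem4p2:
  fixes scale :: "bit \<Rightarrow> 'v::ab_group_add \<Rightarrow> 'v"
    and Basis :: "'v set"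
    and f :: "'v \<Rightarrow> 'v"
    and m k :: nat
    and t i :: "nat \<Rightarrow> nat"
    and J :: "nat set"
    and \<mu>J \<mu> r :: "nat \<Rightarrow> int"
  assumes "finite_dimensional_vector_space scale Basis"
    and "Vector_Spaces.linear scale scale f"
    and "\<exists>n. \<forall>v. (f ^^ n) v = 0"
    and "has_elementary_divisors scale f m t"
    and "mono_on {1..m} t"
    and "2 \<le> k"
    and "strict_mono_on {1..k} i"
    and "J = i ` {1..k}"
    and "J \<subseteq> unrepeated m t"
    and "\<mu>J \<in> tuple_lattice k (t \<circ> i)"
    and "is_maximum_extension m t k i \<mu>J \<mu>"
    and "r = (\<lambda>j. \<mu> j + (\<Sum>l\<in>J. unit_row l j))"
  shows
    "(0 \<le> \<mu>J 1 \<and> strict_mono_on {1..k} \<mu>J \<and>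
      0 < int (t (i 1)) - \<mu>J 1 \<and> strict_mono_on {1..k} (\<lambda>s. int (t (i s)) - \<mu>J s))
     \<longleftrightarrow>
     (r \<in> tuple_lattice m t \<and>
      (\<exists>X. characteristic scale f X \<and> \<not> hyperinvariant scale f X \<and>
           hyper_frame scale f X = (W f m t r, W f m t \<mu>)))"
proof -
  obtain u where u: "\<forall>j\<in>{1..m}. (f ^^ t j) (u j) = 0 \<and> (f ^^ (t j - 1)) (u j) \<noteq> 0"
    "\<forall>v. \<exists>!w. w \<in> (\<Pi>\<^sub>E j\<in>{1..m}. cyclic_subspace scale f (u j)) \<and> v = (\<Sum>j\<in>{1..m}. w j)"
    using assms(4) unfolding has_elementary_divisors_def by blast
  interpret cyclic_decomposition scale f m t u
  proof (intro cyclic_decomposition.intro vector_space_endo.intro)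
    show "vector_space scale"
      using assms(1) by (rule finite_dimensional_vector_space.axioms(1))
    show "vector_space_endo_axioms scale f"
      using assms(2) by (rule vector_space_endo_axioms.intro)
    show "cyclic_decomposition_axioms scale f m t u"
      using u by (intro cyclic_decomposition_axioms.intro) auto
  qed
  note t = \<open>mono_on {1..m} t\<close> and i = \<open>strict_mono_on {1..k} i\<close>
  have J: "i s \<in> J" "i s \<in> {1..m}" if "s \<in> {1..k}" for s
    using that assms(8,9) unfolding unrepeated_def by blast+
  have \<mu>: "\<mu> \<in> tuple_lattice m t" and \<mu>i: "\<And>s. s \<in> {1..k} \<Longrightarrow> \<mu> (i s) = \<mu>J s"
    using assms(11) unfolding is_maximum_extension_def is_extension_def by auto
  have r: "r j = \<mu> j + (if j \<in> J then 1 else 0)" for j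
    using assms(8) unfolding assms(12) unit_row_def by simp
  show ?thesis (is "?i \<longleftrightarrow> ?ii")
  proof
    assume ?i
    then have strict: "strict_mono_on {1..k} \<mu>J" "strict_mono_on {1..k} (\<lambda>s. int (t (i s)) - \<mu>J s)"
      and pos1: "0 < int (t (i 1)) - \<mu>J 1" by blast+
    have pos: "\<mu>J s < int (t (i s))" if s: "s \<in> {1..k}" for s
      using strict_mono_onD[OF strict(2) _ s, of 1] pos1 s by (cases "s = 1") auto
    have gap: "\<mu> a + 1 + min 0 (int (t l) - int (t a)) \<le> \<mu> l"
      if "a \<in> J" "l \<in> {1..m}" "l \<noteq> a" for a l
    proof -
      obtain s where s: "s \<in> {1..k}" "a = i s" using \<open>a \<in> J\<close> assms(8) by blast
      show ?thesis
        using maximum_extension_gap[OF t i _ assms(10,11) strict pos s(1), of l] that s \<mu>i assms(8,9)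
        by simp
    qed
    have \<mu>_le: "\<mu> j \<le> \<mu> l" "int (t j) - \<mu> j \<le> int (t l) - \<mu> l"
      if "j \<in> {1..m}" "l \<in> {1..m}" "j \<le> l" for j l
      using \<mu> mono_onD[of "{1..m}" \<mu>, OF _ that]
        mono_onD[of "{1..m}" "\<lambda>j. int (t j) - \<mu> j", OF _ that]
      unfolding tuple_lattice_def by blast+
    have t_le: "t j \<le> t l" if "j \<in> {1..m}" "l \<in> {1..m}" "j \<le> l" for j l
      using mono_onD[OF t that] .
    have rL: "r \<in> tuple_lattice m t"
      unfolding tuple_lattice_def
    proof (intro CollectI conjI ballI mono_onI)
      fix j assume j: "j \<in> {1..m}"
      have \<mu>j: "0 \<le> \<mu> j" "0 \<le> int (t j) - \<mu> j"
        using \<mu> j unfolding tuple_lattice_def by blast+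
      then show "0 \<le> r j" unfolding r by simp
      have "\<mu> j < int (t j)" if "j \<in> J"
        using that pos \<mu>i assms(8) by auto
      then show "0 \<le> int (t j) - r j" using \<mu>j unfolding r by (cases "j \<in> J") auto
    next
      fix j l assume jl: "j \<in> {1..m}" "l \<in> {1..m}" "j \<le> l"
      \<comment> \<open>If only one of the two entries is raised, \<open>gap\<close> absorbs the
        increment: its \<open>min\<close> term is zero for this inequality and
        \<open>t j - t l\<close> for the next.\<close>
      show "r j \<le> r l"
        using gap[of j l] \<mu>_le[OF jl] t_le[OF jl] jl unfolding r by (cases "j = l") auto
      show "int (t j) - r j \<le> int (t l) - r l"
        using gap[of l j] \<mu>_le[OF jl] t_le[OF jl] jl unfolding r by (cases "j = l") auto
    qed
    \<comment> \<open>For \<open>j\<close> in \<open>J\<close> this is \<open>gap\<close> with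
      \<open>j\<close> as the raised index; otherwise the lattice conditions on \<mu>
      suffice.\<close>
    have "r j \<le> \<mu> a + max 0 (int (t j) - int (t a))"
      if a: "a \<in> J" and j: "j \<in> {1..m}" "j \<noteq> a" for a j
    proof -
      have a1: "a \<in> {1..m}" using a J assms(8) by auto
      show ?thesis
        using gap[of j a] \<mu>_le[OF a1 j(1)] \<mu>_le[OF j(1) a1] a1 j
        unfolding r by (cases "j \<le> a") auto
    qed
    moreover have "i 1 \<in> J" "i 2 \<in> J" "i 1 \<noteq> i 2"
      using assms(6) J(1) strict_mono_onD[OF i, of 1 2] by auto
    moreover have "c = 1" if "c \<noteq> 0" for c :: bit
      using that by (cases c) auto
    ultimately show ?ii
      using exists_characteristic_frame[OF _ assms(9) _ _ _ \<mu> rL r] rL by blast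
  next
    assume ?ii
    then obtain X where rL: "r \<in> tuple_lattice m t" and X: "characteristic scale f X"
      and frame: "hyper_frame scale f X = (W f m t r, W f m t \<mu>)" by blast
    \<comment> \<open>Contrapositive of \<open>frame_gap\<close> with \<open>a = i s\<close> and
      \<open>b = i s'\<close>, available in both orders of the two indices.\<close>
    have gap: "\<mu>J s' > \<mu>J s \<or> int (t (i s)) - \<mu>J s > int (t (i s')) - \<mu>J s'"
      if s: "s \<in> {1..k}" "s' \<in> {1..k}" "s \<noteq> s'" for s s'
    proof -
      have "i s \<noteq> i s'" using i s by (metis linorder_neqE_nat less_irrefl strict_mono_onD)
      then show ?thesis
        using frame_gap[OF X frame \<mu> rL J(2)[OF s(1)] J(2)[OF s(2)]] \<mu>i s J r
        by fastforce
    qed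
    have le: "\<mu>J s \<le> \<mu>J s'" "int (t (i s)) - \<mu>J s \<le> int (t (i s')) - \<mu>J s'"
      if "s \<in> {1..k}" "s' \<in> {1..k}" "s < s'" for s s'
      using assms(10) that mono_onD[of "{1..k}" \<mu>J s s']
        mono_onD[of "{1..k}" "\<lambda>j. int ((t \<circ> i) j) - \<mu>J j" s s']
      unfolding tuple_lattice_def by auto
    have k1: "1 \<in> {1..k}" using assms(6) by simp
    have "0 \<le> \<mu>J 1" using assms(10) k1 unfolding tuple_lattice_def by blast
    moreover have "strict_mono_on {1..k} \<mu>J"
    proof (rule strict_mono_onI)
      fix s s' assume s: "s \<in> {1..k}" "s' \<in> {1..k}" "s < s'"
      \<comment> \<open>For \<open>s < s'\<close> the weak inequalities rule out the second
        alternative of \<open>gap\<close>; with the indices exchanged they rule out the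
        first.\<close>
      show "\<mu>J s < \<mu>J s'" using gap[of s s'] le[OF s] s by auto
    qed
    moreover have "0 < int (t (i 1)) - \<mu>J 1"
    proof -
      \<comment> \<open>Positivity comes from the raised entry,
        \<open>\<mu>J 1 + 1 = r (i 1) \<le> t (i 1)\<close>.\<close>
      have "0 \<le> int (t (i 1)) - r (i 1)" using rL J(2)[OF k1] unfolding tuple_lattice_def by blast
      then show ?thesis using r[of "i 1"] J(1)[OF k1] \<mu>i[OF k1] by simp
    qed
    moreover have "strict_mono_on {1..k} (\<lambda>s. int (t (i s)) - \<mu>J s)"
    proof (rule strict_mono_onI)
      fix s s' assume s: "s \<in> {1..k}" "s' \<in> {1..k}" "s < s'"
      show "int (t (i s)) - \<mu>J s < int (t (i s')) - \<mu>J s'" using gap[of s' s] le[OF s] s by auto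
    qed
    ultimately show ?i by blast
  qed
qed

end
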